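(* Let $\kappa\ge1$, $\gamma\in(0,1)$, and assume $\mathcal K_{\kappa,\gamma}\ne\varnothing$. Choose $K_0$ with $A-BK_0$ Schur stable and $\max\{1,\Lambda(K_0),\Lambda_B(K_0)\}\le 2\,\mathfrak C(A,B)$, and the truncation length $$H_\gamma=\left\lceil\frac1\gamma\log\!\left(2+\frac{C_0\sqrt T}{\Psi_0}\right)\right\rceil ,$$ so that in particular $H_\gamma=O(\gamma^{-1}\log(2+T/\gamma))$. Then there is a constant $C_{\rm sys}$, depending only on $d_x,d_u,\kappa$ and $\mathfrak C(A,B)$ (and not on $T,W,\gamma,L,G$), such that the weighted-response controller described in the context satisfies: (i) for globally $L$-Lipschitz convex costs (running the controller with this $L$), $$\mathrm{Reg}_T(\mathcal K_{\kappa,\gamma})\le C_{\rm sys}LW\gamma^{-1}\sqrt T;$$ (ii) there is a radius $D_\gamma\le C_{\rm sys}W/\gamma$ such that the physical trajectory $y_t$, the reference trajectory $y_t^{M_t}$ and every comparator trajectory $y_t^K$, $K\in\mathcal K_{\kappa,\gamma}$, lie in the ball of radius $D_\gamma$ for all $t\le T$; and for $(G,D_\gamma)$-regular convex costs (running the controller with $L=GD_\gamma$), $$\mathrm{Reg}_T(\mathcal K_{\kappa,\gamma})\le C_{\rm sys}GW^2\gamma^{-2}\sqrt T.$$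
   Context: Model: $A\in\mathbb R^{d_x\times d_x}$, $B\in\mathbb R^{d_x\times d_u}$ are known; $x_1=0$ and $x_{t+1}=Ax_t+Bu_t+w_t$ with $\|w_t\|\le W$. On round $t=1,\dots,T$ the learner observes $x_t$, chooses $u_t$, incurs $c_t(x_t,u_t)$, then observes the whole function $c_t$ and $x_{t+1}$ (hence $w_t$). The environment may choose $c_t,w_t$ as a function of previously revealed history but not of the current action; bounds are pathwise. Write $y_t=(x_t,u_t)$; $\|\cdot\|$ is Euclidean, $\|(x,u)\|^2=\|x\|^2+\|u\|^2$; $\|\cdot\|_{\rm op},\|\cdot\|_{\rm F}$ are operator and Frobenius norms. Benchmark: $\mathcal K_{\kappa,\gamma}=\{K\in\mathbb R^{d_u\times d_x}:\|K\|_{\rm op}\le\kappa,\ \|(A-BK)^r\|_{\rm op}\le\kappa^2(1-\gamma)^r\ \forall r\ge0\}$; $K$ denotes the policy $u_t=-Kx_t$, and $y_t^K=(x_t^K,u_t^K)$ its trajectory from $x_1^K=0$ on the same realized disturbances. $\mathrm{Reg}_T(\mathcal K_{\kappa,\gamma})=\sum_{t\le T}c_t(y_t)-\inf_{K}\sum_{t\le T}c_t(y_t^K)$. Costs: globally $L$-Lipschitz means $|c_t(y)-c_t(y')|\le L\|y-y'\|$ for all $y,y'$. A convex cost is $(G,D)$-regular if it is differentiable with $\|\nabla c_t(y)\|\le GD$ on the radius-$D$ ball. Tracker quantities: $F_0=A-BK_0$, $\Lambda(K_0)=\sum_{r\ge0}\left\|\begin{bmatrix}I\\-K_0\end{bmatrix}F_0^r\right\|_{\rm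 op}$, $\Lambda_B(K_0)=\sum_{r\ge0}\|F_0^rB\|_{\rm op}$, and $\mathfrak C(A,B)=\inf\{\max\{1,\Lambda(K),\Lambda_B(K)\}: A-BK\text{ Schur stable}\}$ (Schur stable: all eigenvalues strictly inside the unit disk). $C_0^2=\Lambda_B(K_0)^2+(1+\|K_0\|_{\rm op}\Lambda_B(K_0))^2$, $\Psi_0^2=C_0^2+2\Lambda(K_0)\Lambda_B(K_0)C_0$ ($C_0,\Psi_0>0$). Weighted-response controller: let $H=H_\gamma$, $\rho=\sqrt{1-\gamma}$, $w_s=0$ for $s\le0$. For $M=(M^{[1]},\dots,M^{[H]})$, $M^{[i]}\in\mathbb R^{d_u\times d_x}$, let $v_t(M)=\sum_{i=1}^HM^{[i]}w_{t-i}$ and let $y_t^M=(x_t^M,u_t^M)$ be given by $x_1^M=0$, $x_{t+1}^M=F_0x_t^M+Bv_t(M)+w_t$, $u_t^M=-K_0x_t^M+v_t(M)$. Put $f_t(M)=c_t(y_t^M)$ (convex in $M$), $\|M\|_\rho^2=\sum_{i=1}^H\rho^{-2(i-1)}\|M^{[i]}\|_{\rm F}^2$, $R_\gamma=\kappa^2\gamma^{-1/2}\sup_{K\in\mathcal K_{\kappa,\gamma}}\|K-K_0\|_{\rm F}$, $S_{\rho,H}^2=\sum_{i=1}^H\rho^{2(i-1)}$. Start with $M_1=0$; play $u_t=-K_0x_t+v_t(M_t)$; then update $M_{t+1}=\mathrm{Proj}(M_t-\eta g_t)$, where $g_t$ is a subgradient of $f_t$ at $M_t$ and $\mathrm{Proj}$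 is the projection onto $\{\|M\|_\rho\le R_\gamma\}$, both taken with respect to the inner product inducing $\|\cdot\|_\rho$, and $\eta=R_\gamma/(LWS_{\rho,H}\Psi_0\sqrt T)$ (arbitrary if $LW=0$). *)

theory Defs
  imports "HOL-Analysis.Analysis"
begin

text \<open>
  The type \<^typ>\<open>real ^ 'n ^ 'm\<close> consists of matrices with \<open>CARD('m)\<close> rows and
  \<open>CARD('n)\<close> columns; states live in \<^typ>\<open>real ^ 'x\<close>, inputs in \<^typ>\<open>real ^ 'u\<close>, and
  \<open>y = (x, u)\<close> in the product, whose library norm is the Euclidean one. The library's
  \<^const>\<open>inner\<close> and \<^const>\<open>norm\<close> on matrices are the Frobenius ones.
\<close>

abbreviation opnorm :: "real ^ 'n ^ 'm \<Rightarrow> real" where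
  "opnorm A \<equiv> onorm ((*v) A)"

text \<open>The overloaded power on vectors is componentwise, hence the separate matrix power.\<close>

primrec mpow :: "real ^ 'n ^ 'n \<Rightarrow> nat \<Rightarrow> real ^ 'n ^ 'n" where
  "mpow F 0 = mat 1"
| "mpow F (Suc r) = F ** mpow F r"

definition schur_stable :: "real ^ 'n ^ 'n \<Rightarrow> bool" where
  "schur_stable F \<longleftrightarrow>
     (\<forall>(z::complex) v. v \<noteq> 0 \<and> map_matrix complex_of_real F *v v = z *s v \<longrightarrow> cmod z < 1)"

definition policy_class ::
  "real ^ 'x ^ 'x \<Rightarrow> real ^ 'u ^ 'x \<Rightarrow> real \<Rightarrow> real \<Rightarrow> (real ^ 'x ^ 'u) set" where
  "policy_class A B \<kappa> \<gamma> =
     {K. opnorm K \<le> \<kappa> \<and> (\<forall>r. opnorm (mpow (A - B ** K) r) \<le> \<kappa>\<^sup>2 * (1 - \<gamma>) ^ r)}"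


subsection \<open>Tracker quantities\<close>

text \<open>
  For Schur stable \<open>A - BK\<close> both series below converge. The map \<open>x \<mapsto> (x, -Kx)\<close> is the
  stacked matrix with blocks \<open>I\<close> and \<open>-K\<close>.
\<close>

definition Lam :: "real ^ 'x ^ 'x \<Rightarrow> real ^ 'u ^ 'x \<Rightarrow> real ^ 'x ^ 'u \<Rightarrow> real" where
  "Lam A B K = (\<Sum>r. onorm (\<lambda>x. (mpow (A - B ** K) r *v x, - (K *v (mpow (A - B ** K) r *v x)))))"

definition LamB :: "real ^ 'x ^ 'x \<Rightarrow> real ^ 'u ^ 'x \<Rightarrow> real ^ 'x ^ 'u \<Rightarrow> real" where
  "LamB A B K = (\<Sum>r. opnorm (mpow (A - B ** K) r ** B))"

definition track_cost :: "real ^ 'x ^ 'x \<Rightarrow> real ^ 'u ^ 'x \<Rightarrow> real ^ 'x ^ 'u \<Rightarrow> real" where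
  "track_cost A B K = Max {1, Lam A B K, LamB A B K}"

definition frakC :: "real ^ 'x ^ 'x \<Rightarrow> real ^ 'u ^ 'x \<Rightarrow> real" where
  "frakC A B = (INF K \<in> {K. schur_stable (A - B ** K)}. track_cost A B K)"

definition C0 :: "real ^ 'x ^ 'x \<Rightarrow> real ^ 'u ^ 'x \<Rightarrow> real ^ 'x ^ 'u \<Rightarrow> real" where
  "C0 A B K0 = sqrt ((LamB A B K0)\<^sup>2 + (1 + opnorm K0 * LamB A B K0)\<^sup>2)"

definition Psi0 :: "real ^ 'x ^ 'x \<Rightarrow> real ^ 'u ^ 'x \<Rightarrow> real ^ 'x ^ 'u \<Rightarrow> real" where
  "Psi0 A B K0 = sqrt ((C0 A B K0)\<^sup>2 + 2 * Lam A B K0 * LamB A B K0 * C0 A B K0)"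

definition trunc_len ::
  "real ^ 'x ^ 'x \<Rightarrow> real ^ 'u ^ 'x \<Rightarrow> real ^ 'x ^ 'u \<Rightarrow> real \<Rightarrow> nat \<Rightarrow> nat" where
  "trunc_len A B K0 \<gamma> T =
     nat \<lceil>1 / \<gamma> * ln (2 + C0 A B K0 * sqrt (real T) / Psi0 A B K0)\<rceil>"


subsection \<open>Trajectories\<close>

text \<open>
  Time starts at 1; the values at index 0 of all sequences are irrelevant.
  \<open>state A B \<pi> w\<close> is the state trajectory of the plant when \<open>u\<^sub>t = \<pi> t x\<^sub>t\<close> is played.
\<close>

fun state ::
  "real ^ 'x ^ 'x \<Rightarrow> real ^ 'u ^ 'x \<Rightarrow> (nat \<Rightarrow> real ^ 'x \<Rightarrow> real ^ 'u) \<Rightarrow> (nat \<Rightarrow> real ^ 'x)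
    \<Rightarrow> nat \<Rightarrow> real ^ 'x" where
  "state A B \<pi> w 0 = 0"
| "state A B \<pi> w (Suc 0) = 0"
| "state A B \<pi> w (Suc (Suc t)) =
     A *v state A B \<pi> w (Suc t) + B *v \<pi> (Suc t) (state A B \<pi> w (Suc t)) + w (Suc t)"

definition traj ::
  "real ^ 'x ^ 'x \<Rightarrow> real ^ 'u ^ 'x \<Rightarrow> (nat \<Rightarrow> real ^ 'x \<Rightarrow> real ^ 'u) \<Rightarrow> (nat \<Rightarrow> real ^ 'x)
    \<Rightarrow> nat \<Rightarrow> (real ^ 'x) \<times> (real ^ 'u)" where
  "traj A B \<pi> w t = (state A B \<pi> w t, \<pi> t (state A B \<pi> w t))"

definition lin_traj ::
  "real ^ 'x ^ 'x \<Rightarrow> real ^ 'u ^ 'x \<Rightarrow> real ^ 'x ^ 'u \<Rightarrow> (nat \<Rightarrow> real ^ 'x)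
    \<Rightarrow> nat \<Rightarrow> (real ^ 'x) \<times> (real ^ 'u)" where
  "lin_traj A B K w = traj A B (\<lambda>t x. - (K *v x)) w"

text \<open>
  A tuple \<open>M = (M\<^bsup>[1]\<^esup>, \<dots>, M\<^bsup>[H]\<^esup>)\<close> is a function on \<^typ>\<open>nat\<close> of which only the values at
  \<open>1, \<dots>, H\<close> are ever read; values elsewhere affect nothing below.
\<close>

type_synonym ('x, 'u) blocks = "nat \<Rightarrow> real ^ 'x ^ 'u"

text \<open>The case distinction encodes \<open>w\<^sub>s = 0\<close> for \<open>s \<le> 0\<close>.\<close>

definition resp :: "nat \<Rightarrow> (nat \<Rightarrow> real ^ 'x) \<Rightarrow> ('x, 'u) blocks \<Rightarrow> nat \<Rightarrow> real ^ 'u" where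
  "resp H w M t = (\<Sum>i = 1..H. M i *v (if i < t then w (t - i) else 0))"

fun ref_state ::
  "real ^ 'x ^ 'x \<Rightarrow> real ^ 'u ^ 'x \<Rightarrow> real ^ 'x ^ 'u \<Rightarrow> nat \<Rightarrow> (nat \<Rightarrow> real ^ 'x)
    \<Rightarrow> ('x, 'u) blocks \<Rightarrow> nat \<Rightarrow> real ^ 'x" where
  "ref_state A B K0 H w M 0 = 0"
| "ref_state A B K0 H w M (Suc 0) = 0"
| "ref_state A B K0 H w M (Suc (Suc t)) =
     (A - B ** K0) *v ref_state A B K0 H w M (Suc t) + B *v resp H w M (Suc t) + w (Suc t)"

definition ref_traj ::
  "real ^ 'x ^ 'x \<Rightarrow> real ^ 'u ^ 'x \<Rightarrow> real ^ 'x ^ 'u \<Rightarrow> nat \<Rightarrow> (nat \<Rightarrow> real ^ 'x)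
    \<Rightarrow> ('x, 'u) blocks \<Rightarrow> nat \<Rightarrow> (real ^ 'x) \<times> (real ^ 'u)" where
  "ref_traj A B K0 H w M t =
     (ref_state A B K0 H w M t, - (K0 *v ref_state A B K0 H w M t) + resp H w M t)"

definition phys_traj ::
  "real ^ 'x ^ 'x \<Rightarrow> real ^ 'u ^ 'x \<Rightarrow> real ^ 'x ^ 'u \<Rightarrow> nat \<Rightarrow> (nat \<Rightarrow> real ^ 'x)
    \<Rightarrow> (nat \<Rightarrow> ('x, 'u) blocks) \<Rightarrow> nat \<Rightarrow> (real ^ 'x) \<times> (real ^ 'u)" where
  "phys_traj A B K0 H w M = traj A B (\<lambda>t x. - (K0 *v x) + resp H w (M t) t) w"


subsection \<open>The weighted-response controller\<close>

definition winner :: "real \<Rightarrow> nat \<Rightarrow> ('x::finite, 'u::finite) blocks \<Rightarrow> ('x, 'u) blocks \<Rightarrow> real" where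
  "winner \<rho> H M N = (\<Sum>i = 1..H. inverse (\<rho> ^ (2 * (i - 1))) * inner (M i) (N i))"

definition wnorm :: "real \<Rightarrow> nat \<Rightarrow> ('x::finite, 'u::finite) blocks \<Rightarrow> real" where
  "wnorm \<rho> H M = sqrt (winner \<rho> H M M)"

definition is_wsubgradient ::
  "real \<Rightarrow> nat \<Rightarrow> (('x::finite, 'u::finite) blocks \<Rightarrow> real) \<Rightarrow> ('x, 'u) blocks \<Rightarrow> ('x, 'u) blocks \<Rightarrow> bool" where
  "is_wsubgradient \<rho> H f M g \<longleftrightarrow> (\<forall>N. f N \<ge> f M + winner \<rho> H g (\<lambda>i. N i - M i))"

definition is_wprojection ::
  "real \<Rightarrow> nat \<Rightarrow> real \<Rightarrow> ('x::finite, 'u::finite) blocks \<Rightarrow> ('x, 'u) blocks \<Rightarrow> bool" where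
  "is_wprojection \<rho> H R N P \<longleftrightarrow>
     is_arg_min (\<lambda>Q. wnorm \<rho> H (\<lambda>i. N i - Q i)) (\<lambda>Q. wnorm \<rho> H Q \<le> R) P"

definition resp_radius ::
  "real ^ 'x ^ 'x \<Rightarrow> real ^ 'u ^ 'x \<Rightarrow> real ^ 'x ^ 'u \<Rightarrow> real \<Rightarrow> real \<Rightarrow> real" where
  "resp_radius A B K0 \<kappa> \<gamma> =
     \<kappa>\<^sup>2 * (1 / sqrt \<gamma>) * (SUP K \<in> policy_class A B \<kappa> \<gamma>. norm (K - K0))"

definition geo_S :: "real \<Rightarrow> nat \<Rightarrow> real" where
  "geo_S \<rho> H = sqrt (\<Sum>i = 1..H. \<rho> ^ (2 * (i - 1)))"

text \<open>
  \<open>M\<close> is a sequence of iterates that the controller, run with Lipschitz parameter \<open>L\<close>,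
  can produce on costs \<open>c\<close> and disturbances \<open>w\<close>. It is a relation because the subgradients,
  and the step size if \<open>L W = 0\<close>, are arbitrary.
\<close>

definition controller_run ::
  "real ^ 'x ^ 'x \<Rightarrow> real ^ 'u ^ 'x \<Rightarrow> real ^ 'x ^ 'u \<Rightarrow> real \<Rightarrow> real \<Rightarrow> nat \<Rightarrow> real \<Rightarrow> real
    \<Rightarrow> (nat \<Rightarrow> (real ^ 'x) \<times> (real ^ 'u) \<Rightarrow> real) \<Rightarrow> (nat \<Rightarrow> real ^ 'x)
    \<Rightarrow> (nat \<Rightarrow> ('x::finite, 'u::finite) blocks) \<Rightarrow> bool" where
  "controller_run A B K0 \<kappa> \<gamma> T W L c w M \<longleftrightarrow>
     (let \<rho> = sqrt (1 - \<gamma>);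
          H = trunc_len A B K0 \<gamma> T;
          R = resp_radius A B K0 \<kappa> \<gamma>
      in \<exists>\<eta>. (L * W \<noteq> 0 \<longrightarrow> \<eta> = R / (L * W * geo_S \<rho> H * Psi0 A B K0 * sqrt (real T))) \<and>
             M 1 = (\<lambda>_. 0) \<and>
             (\<forall>t \<in> {1..T}. \<exists>g.
                is_wsubgradient \<rho> H (\<lambda>N. c t (ref_traj A B K0 H w N t)) (M t) g \<and>
                is_wprojection \<rho> H R (\<lambda>i. M t i - \<eta> *\<^sub>R g i) (M (Suc t))))"

definition regret ::
  "real ^ 'x ^ 'x \<Rightarrow> real ^ 'u ^ 'x \<Rightarrow> (real ^ 'x ^ 'u) set \<Rightarrow> nat
    \<Rightarrow> (nat \<Rightarrow> (real ^ 'x) \<times> (real ^ 'u) \<Rightarrow> real) \<Rightarrow> (nat \<Rightarrow> real ^ 'x)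
    \<Rightarrow> (nat \<Rightarrow> (real ^ 'x) \<times> (real ^ 'u)) \<Rightarrow> real" where
  "regret A B \<K> T c w y =
     (\<Sum>t = 1..T. c t (y t)) - (INF K \<in> \<K>. \<Sum>t = 1..T. c t (lin_traj A B K w t))"

definition regular_cost :: "real \<Rightarrow> real \<Rightarrow> ('a::euclidean_space \<Rightarrow> real) \<Rightarrow> bool" where
  "regular_cost G D f \<longleftrightarrow> convex_on UNIV f \<and>
     (\<exists>f'. (\<forall>y. GDERIV f y :> f' y) \<and> (\<forall>y \<in> cball 0 D. norm (f' y) \<le> G * D))"

end

theory Submission
  imports Defs "HOL-Computational_Algebra.Fundamental_Theorem_Algebra"
begin

text \<open>
  Along the trajectory of a comparator \<open>K\<close> one has \<open>u\<^sub>t + K\<^sub>0 x\<^sub>t = (K\<^sub>0 - K) x\<^sub>t\<close>, and \<open>x\<^sub>t\<close> is the sum of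
  \<open>(A - BK)\<^bsup>i-1\<^esup> w\<^bsub>t-i\<^esub>\<close>. Hence the blocks \<open>(K\<^sub>0 - K)(A - BK)\<^bsup>i-1\<^esup>\<close>, truncated at \<open>H\<close>, lie in the ball of
  radius \<open>R\<^sub>\<gamma>\<close> and reproduce the comparator up to an error of order \<open>(1 - \<gamma>)\<^sup>H / \<gamma>\<close>, which the choice
  of \<open>H\<close> makes \<open>O(1 / (\<gamma> \<surd>T))\<close>. Against these blocks, subgradient descent on the reference costs \<open>f\<^sub>t\<close> has
  the usual regret. The physical trajectory differs from the reference one by
  \<open>e\<^bsub>t+1\<^esub> = F\<^sub>0 e\<^sub>t + \<delta>\<^bsub>t+1\<^esub>\<close>, where \<open>\<delta>\<^bsub>t+1\<^esub>\<close> is the change of the reference state when \<open>M\<^sub>t\<close> is replaced by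
  \<open>M\<^bsub>t+1\<^esub>\<close> and is proportional to the step size. Both effects together replace the factor \<open>C\<^sub>0\<^sup>2\<close> of
  the standard regret bound by \<open>\<Psi>\<^sub>0\<^sup>2\<close>, and the step size balances the two terms.

  The series defining the tracker quantities converge because every vector is annihilated by some
  polynomial in \<open>F\<^sub>0\<close>; splitting off its roots one at a time reduces summability of the orbit to the
  scalar recursion \<open>a\<^bsub>r+1\<^esub> \<le> \<bar>z\<bar> a\<^sub>r + b\<^sub>r\<close> with \<open>\<bar>z\<bar> < 1\<close> and summable \<open>b\<close>.
\<close>


subsection \<open>Powers of a Schur stable matrix\<close>

text \<open>The vector p(F) v by Horner's scheme, so that no polynomial in the matrix itself has to
  be formed.\<close>

definition poly_act :: "complex ^ 'n ^ 'n \<Rightarrow> complex poly \<Rightarrow> complex ^ 'n \<Rightarrow> complex ^ 'n" where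
  "poly_act F p v = fold_coeffs (\<lambda>c u. c *s v + F *v u) p 0"

lemma poly_act_0 [simp]: "poly_act F 0 v = 0"
  by (simp add: poly_act_def)

lemma poly_act_pCons: "poly_act F (pCons c p) v = c *s v + F *v poly_act F p v"
  by (cases "p = 0 \<and> c = 0") (auto simp: poly_act_def)

lemma poly_act_add: "poly_act F (p + q) v = poly_act F p v + poly_act F q v"
  by (induction p q rule: poly_induct2)
    (auto simp: poly_act_pCons vec.add vector_sadd_rdistrib algebra_simps matrix_vector_right_distrib)

lemma poly_act_smult: "poly_act F (smult c p) v = c *s poly_act F p v"
  by (induction p)
    (auto simp: poly_act_pCons vector_smult_assoc vector_add_ldistrib vec.scale)

lemma poly_act_monom: "poly_act F (monom c i) v = c *s (((*v) F ^^ i) v)"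
  by (induction i) (auto simp: poly_act_pCons monom_Suc monom_0 vec.scale)

lemma poly_act_sum: "poly_act F (\<Sum>i\<in>I. p i) v = (\<Sum>i\<in>I. poly_act F (p i) v)"
  by (induction I rule: infinite_finite_induct) (auto simp: poly_act_add)

lemma poly_act_add_right: "poly_act F p (u + v) = poly_act F p u + poly_act F p v"
  by (induction p) (auto simp: poly_act_pCons vector_add_ldistrib matrix_vector_right_distrib)

lemma poly_act_scale_right: "poly_act F p (c *s v) = c *s poly_act F p v"
  by (induction p)
    (auto simp: poly_act_pCons vector_add_ldistrib vec.scale vector_smult_assoc mult.commute)

lemma poly_act_mult_right: "poly_act F p (F *v v) = F *v poly_act F p v"
  by (induction p) (auto simp: poly_act_pCons matrix_vector_right_distrib vec.scale)

lemma poly_act_linear_factor: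
  "poly_act F ([:-z, 1:] * p) v = F *v poly_act F p v - z *s poly_act F p v"
proof -
  have "[:-z, 1:] * p = pCons 0 p + smult (-z) p"
    by simp
  then show ?thesis
    by (simp only: poly_act_add poly_act_smult poly_act_pCons) (simp add: vec.scale_minus_left)
qed

text \<open>The family is indexed, so a repeated vector must count as a dependence: it yields the
  coefficients 1 and -1, while an injective family has too many members to be independent as a
  set.\<close>

lemma ex_linear_dependence:
  fixes f :: "nat \<Rightarrow> 'a::euclidean_space"
  shows "\<exists>c. (\<Sum>i\<le>DIM('a). c i *\<^sub>R f i) = 0 \<and> (\<exists>i\<le>DIM('a). c i \<noteq> (0::real))"
proof (cases "inj_on f {..DIM('a)}")
  case True
  then have "card (f ` {..DIM('a)}) > DIM('a)"
    by (simp add: card_image)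
  then have "dependent (f ` {..DIM('a)})"
    by (intro dependent_biggerset) auto
  then obtain u where u: "\<exists>v\<in>f ` {..DIM('a)}. u v \<noteq> 0" "(\<Sum>v\<in>f ` {..DIM('a)}. u v *\<^sub>R v) = 0"
    by (subst (asm) dependent_finite) auto
  show ?thesis
    by (rule exI[of _ "u \<circ> f"]) (use u True in \<open>auto simp: sum.reindex\<close>)
next
  case False
  then obtain i j where ij: "i \<le> DIM('a)" "j \<le> DIM('a)" "i \<noteq> j" "f i = f j"
    by (auto simp: inj_on_def)
  let ?c = "\<lambda>k. (if k = i then 1 else 0) - (if k = j then 1 else (0::real))"
  have "(\<Sum>k\<le>DIM('a). ?c k *\<^sub>R f k) = 0"
    using ij by (simp add: scaleR_left_diff_distrib sum_subtractf if_distrib[of "\<lambda>a. a *\<^sub>R _"] sum.delta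
        cong: if_cong)
  then show ?thesis
    using ij by (intro exI[of _ ?c]) auto
qed

text \<open>The iterates v, F v, F^2 v, ... become linearly dependent once their number exceeds the
  real dimension of the space; the coefficients of a dependence are those of the polynomial. This
  avoids Cayley-Hamilton.\<close>

lemma ex_annihilating_poly:
  fixes F :: "complex ^ 'n ^ 'n"
  shows "\<exists>p. p \<noteq> 0 \<and> poly_act F p v = 0"
proof -
  let ?d = "DIM(complex ^ 'n)"
  obtain c where c: "(\<Sum>i\<le>?d. c i *\<^sub>R ((*v) F ^^ i) v) = 0" and "\<exists>i\<le>?d. c i \<noteq> 0"
    using ex_linear_dependence[of "\<lambda>i. ((*v) F ^^ i) v"] by auto
  then obtain i where i: "i \<le> ?d" "c i \<noteq> 0"
    by auto
  let ?p = "\<Sum>i\<le>?d. monom (complex_of_real (c i)) i"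
  have "coeff ?p i = c i"
    using i by (simp add: coeff_sum sum.delta)
  then have "?p \<noteq> 0"
    using i by auto
  moreover have "of_real a *s u = a *\<^sub>R u" for a and u :: "complex ^ 'n"
    by (vector scaleR_conv_of_real)
  with c have "poly_act F ?p v = 0"
    by (simp add: poly_act_sum poly_act_monom)
  ultimately show ?thesis
    by blast
qed

text \<open>Summing the recursion bounds each partial sum s by a 0 + q s + \<open>suminf b\<close>,
  which is solved for s because q < 1.\<close>

lemma summable_perturbed_contraction:
  fixes a b :: "nat \<Rightarrow> real"
  assumes a: "\<And>n. a n \<ge> 0" and b: "\<And>n. b n \<ge> 0" "summable b"
    and q: "0 \<le> q" "q < 1" and step: "\<And>n. a (Suc n) \<le> q * a n + b n"
  shows "summable a"
proof (rule summableI_nonneg_bounded[where x = "(a 0 + suminf b) / (1 - q)"])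
  fix n
  have "sum a {..<n} \<le> sum a {..<Suc n}"
    using a by simp
  also have "\<dots> = a 0 + (\<Sum>i<n. a (Suc i))"
    by (rule sum.lessThan_Suc_shift)
  also have "(\<Sum>i<n. a (Suc i)) \<le> (\<Sum>i<n. q * a i + b i)"
    by (intro sum_mono step)
  also have "\<dots> = q * sum a {..<n} + sum b {..<n}"
    by (simp add: sum.distrib sum_distrib_left)
  also have "sum b {..<n} \<le> suminf b"
    using b by (intro sum_le_suminf) auto
  finally show "sum a {..<n} \<le> (a 0 + suminf b) / (1 - q)"
    using q by (simp add: field_simps)
qed (use a in auto)

text \<open>Induction on the degree, for all vectors at once. If p = (X - z) q and u = q(F) v, then
  F u = z u. Either u = 0 and q already annihilates v, or z is an eigenvalue, so |z| < 1; then q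
  annihilates (F - z) v, whose summable orbit is the perturbation in the recursion for the orbit of
  v.\<close>

lemma summable_orbit_if_annihilated:
  fixes F :: "complex ^ 'n ^ 'n"
  assumes ev: "\<And>z v. v \<noteq> 0 \<Longrightarrow> F *v v = z *s v \<Longrightarrow> cmod z < 1"
    and "p \<noteq> 0" "poly_act F p v = 0"
  shows "summable (\<lambda>r. norm (((*v) F ^^ r) v))"
  using assms(2,3)
proof (induction "degree p" arbitrary: p v)
  case 0
  then obtain c where "p = [:c:]" "c \<noteq> 0"
    by (metis degree_eq_zeroE pCons_0_0)
  with 0 have "v = 0"
    by (simp add: poly_act_pCons vec.scale_eq_0_iff)
  moreover have "((*v) F ^^ r) 0 = 0" for r
    by (induction r) auto
  ultimately show ?case
    by simp
next
  case (Suc n)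
  have "\<not> constant (poly p)"
    using Suc.hyps(2) by (simp add: constant_degree)
  then obtain z where "poly p z = 0"
    using fundamental_theorem_of_algebra by blast
  then obtain q where pq: "p = [:-z, 1:] * q"
    by (auto simp: poly_eq_0_iff_dvd)
  have q: "q \<noteq> 0"
    using Suc.prems pq by auto
  then have "degree p = 1 + degree q"
    unfolding pq by (subst degree_mult_eq) auto
  then have deg: "degree q = n"
    using Suc.hyps(2) by simp
  let ?u = "poly_act F q v"
  have u: "F *v ?u = z *s ?u"
    using Suc.prems pq by (simp only: poly_act_linear_factor) simp
  show ?case
  proof (cases "?u = 0")
    case True
    then show ?thesis
      using Suc.hyps(1) q deg by blast
  next
    case False
    then have z: "cmod z < 1"
      using ev u by blast
    let ?v = "F *v v + (-z) *s v"
    have "poly_act F q ?v = 0"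
      by (simp only: poly_act_add_right poly_act_mult_right poly_act_scale_right u)
        (simp add: vec.scale_minus_left)
    then have sm: "summable (\<lambda>r. norm (((*v) F ^^ r) ?v))"
      using Suc.hyps(1) q deg by blast
    have pw: "((*v) F ^^ r) (F *v v) = z *s ((*v) F ^^ r) v + ((*v) F ^^ r) ?v" for r
      by (induction r) (auto simp: matrix_vector_right_distrib vec.scale)
    show ?thesis
    proof (rule summable_perturbed_contraction[OF _ _ sm])
      fix r
      have "((*v) F ^^ Suc r) v = z *s ((*v) F ^^ r) v + ((*v) F ^^ r) ?v"
        using pw[of r] by (metis comp_apply funpow_Suc_right)
      moreover have "norm (z *s u) = cmod z * norm u" for u :: "complex ^ 'n"
        by (simp add: norm_vec_def norm_mult L2_set_right_distrib)
      ultimately show "norm (((*v) F ^^ Suc r) v)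
          \<le> cmod z * norm (((*v) F ^^ r) v) + norm (((*v) F ^^ r) ?v)"
        by (metis norm_triangle_ineq)
    qed (use z in auto)
  qed
qed

section \<open>Operator norms of real matrices and of their powers\<close>

lemma matrix_vector_bounded_linear [simp, intro]:
  "bounded_linear ((*v) (M :: real ^ 'n ^ 'm))"
  by (simp add: linear_conv_bounded_linear[symmetric])

lemma opnorm_nonneg [simp]: "opnorm (M :: real ^ 'n ^ 'm) \<ge> 0"
  by (simp add: onorm_pos_le)

lemma norm_matrix_vector_le_opnorm: "norm (M *v x) \<le> opnorm M * norm (x :: real ^ 'n)"
  by (simp add: onorm)

lemma opnorm_le_sum_columns:
  fixes M :: "real ^ 'n ^ 'm"
  shows "opnorm M \<le> (\<Sum>j\<in>UNIV. norm (M *v axis j 1))"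
proof (rule onorm_le)
  fix x :: "real ^ 'n"
  have "M *v x = (\<Sum>j\<in>UNIV. (x $ j) *\<^sub>R (M *v axis j 1))"
    by (simp only: matrix_mult_sum[of M x] matrix_vector_mult_basis scalar_mult_eq_scaleR)
  also have "norm \<dots> \<le> (\<Sum>j\<in>UNIV. norm (M *v axis j 1) * norm x)"
    by (rule sum_norm_le) (simp add: mult.commute mult_right_mono component_le_norm_cart)
  finally show "norm (M *v x) \<le> (\<Sum>j\<in>UNIV. norm (M *v axis j 1)) * norm x"
    by (simp add: sum_distrib_right)
qed

text \<open>Stability speaks of complex eigenvalues, so orbits are studied after an embedding into
  complex vectors that preserves norms and commutes with the matrix. The orbits of the finitely many
  basis vectors control the operator norm.\<close>

lemma schur_stable_summable_opnorm:
  fixes F :: "real ^ 'n ^ 'n"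
  assumes "schur_stable F"
  shows "summable (\<lambda>r. opnorm (mpow F r))"
proof -
  let ?F = "map_matrix complex_of_real F"
  let ?c = "\<lambda>x. (\<chi> i. complex_of_real (x $ i)) :: complex ^ 'n"
  have cF: "?c (F *v x) = ?F *v ?c x" for x
    by (simp add: vec_eq_iff matrix_vector_mult_def)
  have pw: "?c (mpow F r *v x) = ((*v) ?F ^^ r) (?c x)" for r x
    by (induction r) (simp_all add: cF flip: matrix_vector_mul_assoc)
  have nc: "norm (?c x) = norm x" for x
    by (simp add: norm_vec_def)
  have "summable (\<lambda>r. norm (((*v) ?F ^^ r) (?c x)))" for x
    using ex_annihilating_poly[of ?F "?c x"] assms summable_orbit_if_annihilated[of ?F]
    unfolding schur_stable_def by metis
  then have "summable (\<lambda>r. norm (mpow F r *v x))" for x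
    by (simp only: nc flip: pw)
  then have "summable (\<lambda>r. \<Sum>j\<in>UNIV. norm (mpow F r *v axis j 1))"
    by (intro summable_sum)
  then show ?thesis
    by (rule summable_comparison_test[rotated])
      (use opnorm_le_sum_columns in auto)
qed


subsection \<open>Frobenius and operator norms\<close>

lemma norm_matrix_vector_le: "norm (M *v x) \<le> norm M * norm x"
  for M :: "real ^ 'n ^ 'm"
proof -
  have "norm (M *v x) = L2_set (\<lambda>i. norm (inner (M $ i) x)) UNIV"
    by (simp add: norm_vec_def matrix_vector_mul_component)
  also have "\<dots> \<le> L2_set (\<lambda>i. norm (M $ i) * norm x) UNIV"
    by (intro L2_set_mono) (auto simp: Cauchy_Schwarz_ineq2)
  also have "\<dots> = norm M * norm x"
    by (simp add: norm_vec_def[of M] flip: L2_set_left_distrib)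
  finally show ?thesis .
qed

text \<open>The square of the left-hand norm is the inner product of z with M M^T z; Cauchy-Schwarz
  bounds it, and one factor cancels.\<close>

lemma norm_transpose_vector_le: "norm (transpose M *v z) \<le> opnorm M * norm z"
  for M :: "real ^ 'n ^ 'm"
proof (cases "transpose M *v z = 0")
  case False
  have "norm (transpose M *v z) * norm (transpose M *v z) = inner z (M *v (transpose M *v z))"
    unfolding power2_eq_square[symmetric] power2_norm_eq_inner transpose_matrix_vector
    by (rule dot_lmul_matrix)
  also have "\<dots> \<le> norm z * (opnorm M * norm (transpose M *v z))"
    by (rule order_trans[OF norm_cauchy_schwarz])
      (intro mult_left_mono norm_matrix_vector_le_opnorm norm_ge_zero)
  finally have "norm (transpose M *v z) * norm (transpose M *v z)
      \<le> (opnorm M * norm z) * norm (transpose M *v z)"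
    by (simp add: mult_ac)
  then show ?thesis
    using False by simp
qed simp

text \<open>The rows of M N are the transpose of N applied to the rows of M.\<close>

lemma norm_matrix_mult_le: "norm (M ** N) \<le> norm M * opnorm N"
  for M :: "real ^ 'n ^ 'm" and N :: "real ^ 'k ^ 'n"
proof -
  have "(M ** N) $ i = transpose N *v (M $ i)" for i
    by (simp add: vec_eq_iff matrix_matrix_mult_def matrix_vector_mult_def transpose_def mult.commute)
  then have "norm (M ** N) = L2_set (\<lambda>i. norm (transpose N *v (M $ i))) UNIV"
    by (simp add: norm_vec_def)
  also have "\<dots> \<le> L2_set (\<lambda>i. opnorm N * norm (M $ i)) UNIV"
    by (intro L2_set_mono norm_transpose_vector_le) auto
  also have "\<dots> = norm M * opnorm N"
    by (simp add: norm_vec_def[of M] mult.commute flip: L2_set_right_distrib)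
  finally show ?thesis .
qed

text \<open>The squared Frobenius norm is the sum of the squared column norms, each at most the
  squared operator norm. This is how the state dimension enters the constants.\<close>

lemma norm_le_sqrt_card_opnorm: "norm M \<le> sqrt (real CARD('n)) * opnorm M"
  for M :: "real ^ 'n ^ 'm"
proof -
  have "(norm M)\<^sup>2 = (\<Sum>i\<in>UNIV. \<Sum>j\<in>UNIV. (M $ i $ j)\<^sup>2)"
    by (simp only: power2_norm_eq_inner inner_vec_def) (simp add: power2_eq_square)
  also have "\<dots> = (\<Sum>j\<in>UNIV. \<Sum>i\<in>UNIV. (M $ i $ j)\<^sup>2)"
    by (rule sum.swap)
  also have "\<dots> = (\<Sum>j\<in>UNIV. (norm (column j M))\<^sup>2)"
    by (simp only: power2_norm_eq_inner inner_vec_def) (simp add: column_def power2_eq_square)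
  also have "\<dots> \<le> (\<Sum>j\<in>(UNIV::'n set). (opnorm M)\<^sup>2)"
    by (intro sum_mono power_mono norm_column_le_onorm) auto
  finally have "(norm M)\<^sup>2 \<le> real CARD('n) * (opnorm M)\<^sup>2"
    by simp
  then have "sqrt ((norm M)\<^sup>2) \<le> sqrt (real CARD('n) * (opnorm M)\<^sup>2)"
    by (rule real_sqrt_le_mono)
  then show ?thesis
    by (simp add: real_sqrt_mult)
qed

lemma opnorm_matrix_mult_le: "opnorm (M ** N) \<le> opnorm M * opnorm N"
  for M :: "real ^ 'n ^ 'm" and N :: "real ^ 'k ^ 'n"
  using onorm_compose[of "(*v) M" "(*v) N"] by (simp add: comp_def matrix_vector_mul_assoc)


subsection \<open>Projected subgradient descent in the weighted geometry\<close>

lemma winner_commute: "winner \<rho> H M N = winner \<rho> H N M"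
  by (simp add: winner_def inner_commute)

lemma winner_add_left:
  "winner \<rho> H (\<lambda>i. M i + N i) P = winner \<rho> H M P + winner \<rho> H N P"
  by (simp add: winner_def inner_add_left algebra_simps sum.distrib)

lemma winner_diff_left:
  "winner \<rho> H (\<lambda>i. M i - N i) P = winner \<rho> H M P - winner \<rho> H N P"
  by (simp add: winner_def inner_diff_left algebra_simps sum_subtractf)

lemma winner_scale_left: "winner \<rho> H (\<lambda>i. a *\<^sub>R M i) P = a * winner \<rho> H M P"
  by (simp add: winner_def sum_distrib_left mult_ac)

lemma winner_add_right:
  "winner \<rho> H P (\<lambda>i. M i + N i) = winner \<rho> H P M + winner \<rho> H P N"
  by (simp add: winner_def inner_add_right algebra_simps sum.distrib)

lemma winner_diff_right:
  "winner \<rho> H P (\<lambda>i. M i - N i) = winner \<rho> H P M - winner \<rho> H P N"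
  by (simp add: winner_def inner_diff_right algebra_simps sum_subtractf)

lemma winner_scale_right: "winner \<rho> H P (\<lambda>i. a *\<^sub>R M i) = a * winner \<rho> H P M"
  by (simp add: winner_def sum_distrib_left mult_ac)

lemmas winner_expand = winner_add_left winner_diff_left winner_scale_left
  winner_add_right winner_diff_right winner_scale_right

lemma winner_self_nonneg [simp]: "winner \<rho> H M M \<ge> 0"
  by (auto simp: winner_def power_mult intro!: sum_nonneg)

lemma wnorm_nonneg [simp]: "wnorm \<rho> H M \<ge> 0"
  by (simp add: wnorm_def)

lemma wnorm_zero [simp]: "wnorm \<rho> H (\<lambda>i. 0) = 0"
  by (simp add: wnorm_def winner_def)

lemma wnorm_power2: "(wnorm \<rho> H M)\<^sup>2 = winner \<rho> H M M"
  by (simp add: wnorm_def)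

lemma wnorm_le_iff: "0 \<le> R \<Longrightarrow> wnorm \<rho> H M \<le> R \<longleftrightarrow> winner \<rho> H M M \<le> R\<^sup>2"
  using abs_le_square_iff[of "wnorm \<rho> H M" R] by (simp add: wnorm_power2)

lemma wnorm_scale: "wnorm \<rho> H (\<lambda>i. a *\<^sub>R M i) = \<bar>a\<bar> * wnorm \<rho> H M"
  by (simp add: wnorm_def winner_expand real_sqrt_mult flip: mult.assoc)

lemma wnorm_diff_commute: "wnorm \<rho> H (\<lambda>i. M i - N i) = wnorm \<rho> H (\<lambda>i. N i - M i)"
  by (simp add: wnorm_def winner_expand winner_commute[of _ _ N M])

text \<open>The weighted norm ignores blocks outside 1..H and is only a seminorm, so vanishing norms
  do not make the tuples equal. The parallelogram identity does the work instead.\<close>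

lemma wnorm_diff_eq_0:
  assumes "wnorm \<rho> H M = 0" "wnorm \<rho> H N = 0"
  shows "wnorm \<rho> H (\<lambda>i. M i - N i) = 0"
proof -
  have "winner \<rho> H M M = 0" "winner \<rho> H N N = 0"
    using assms by (simp_all add: wnorm_def)
  then have "winner \<rho> H (\<lambda>i. M i - N i) (\<lambda>i. M i - N i)
      = - winner \<rho> H (\<lambda>i. M i + N i) (\<lambda>i. M i + N i)"
    by (simp add: winner_expand winner_commute[of _ _ N M])
  then have "winner \<rho> H (\<lambda>i. M i - N i) (\<lambda>i. M i - N i) = 0"
    using winner_self_nonneg[of \<rho> H "\<lambda>i. M i - N i"] winner_self_nonneg[of \<rho> H "\<lambda>i. M i + N i"]
    by linarith
  then show ?thesis
    by (simp add: wnorm_def)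
qed

section \<open>Projection onto the weighted ball and the resulting descent inequality\<close>

lemma wprojection_in_ball: "is_wprojection \<rho> H R N P \<Longrightarrow> wnorm \<rho> H P \<le> R"
  by (simp add: is_wprojection_def is_arg_min_def)

text \<open>If the inner product a were positive, moving from P a fraction s towards Q would stay in
  the ball by convexity and change the squared distance to N by -2 s a + s^2 b, which is negative
  for small s.\<close>

lemma wprojection_variational:
  assumes P: "is_wprojection \<rho> H R N P" and Q: "wnorm \<rho> H Q \<le> R"
  shows "winner \<rho> H (\<lambda>i. N i - P i) (\<lambda>i. Q i - P i) \<le> 0" (is "?a \<le> 0")
proof (rule ccontr)
  assume neg: "\<not> ?a \<le> 0"
  define a where "a = ?a"
  define b where "b = winner \<rho> H (\<lambda>i. Q i - P i) (\<lambda>i. Q i - P i)"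
  \<comment> \<open>This makes s b at most a; the added 1 keeps the quotient meaningful when b =
    0.\<close>
  define s where "s = min 1 (a / (b + 1))"
  have a: "a > 0" and b: "b \<ge> 0"
    using neg by (auto simp: a_def b_def)
  then have s: "0 < s" "s \<le> 1"
    by (auto simp: s_def)
  have R: "0 \<le> R"
    using Q wnorm_nonneg order_trans by blast
  let ?Z = "\<lambda>i. P i + s *\<^sub>R (Q i - P i)"
  have "winner \<rho> H ?Z ?Z
      = (1 - s) * winner \<rho> H P P + s * winner \<rho> H Q Q - s * (1 - s) * b"
    by (simp add: b_def winner_expand winner_commute[of _ _ Q P] algebra_simps)
  also have "\<dots> \<le> (1 - s) * R\<^sup>2 + s * R\<^sup>2 - 0"
    using s b R Q wprojection_in_ball[OF P]
    by (intro add_mono diff_mono mult_left_mono) (auto simp: wnorm_le_iff)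
  finally have "wnorm \<rho> H ?Z \<le> R"
    using R by (simp add: wnorm_le_iff algebra_simps)
  then have "wnorm \<rho> H (\<lambda>i. N i - P i) \<le> wnorm \<rho> H (\<lambda>i. N i - ?Z i)"
    using P by (auto simp: is_wprojection_def is_arg_min_def not_less)
  then have "winner \<rho> H (\<lambda>i. N i - P i) (\<lambda>i. N i - P i)
      \<le> winner \<rho> H (\<lambda>i. N i - ?Z i) (\<lambda>i. N i - ?Z i)"
    by (simp add: wnorm_def)
  also have "\<dots> = winner \<rho> H (\<lambda>i. N i - P i) (\<lambda>i. N i - P i) - 2 * s * a + s\<^sup>2 * b"
    by (simp add: a_def b_def winner_expand winner_commute[of _ _ Q P]
        winner_commute[of _ _ N P] winner_commute[of _ _ N Q] algebra_simps power2_eq_square)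
  finally have "s * (2 * a) \<le> s * (s * b)"
    by (simp add: power2_eq_square)
  then have "2 * a \<le> s * b"
    using s by (simp only: mult_le_cancel_left_pos)
  also have "s * b \<le> (a / (b + 1)) * b"
    using b by (intro mult_right_mono) (auto simp: s_def)
  also have "\<dots> \<le> a"
    using a b by (simp add: field_simps)
  finally show False
    using a by simp
qed

text \<open>Expanding the square around P leaves a nonnegative term and a cross term of known sign.
  Besides serving the regret bound, the case where Q is the current iterate bounds the movement per
  step.\<close>

lemma wprojection_dist_le:
  assumes "is_wprojection \<rho> H R N P" and "wnorm \<rho> H Q \<le> R"
  shows "wnorm \<rho> H (\<lambda>i. P i - Q i) \<le> wnorm \<rho> H (\<lambda>i. N i - Q i)"
proof -
  have "winner \<rho> H (\<lambda>i. N i - Q i) (\<lambda>i. N i - Q i)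
      = winner \<rho> H (\<lambda>i. N i - P i) (\<lambda>i. N i - P i)
        - 2 * winner \<rho> H (\<lambda>i. N i - P i) (\<lambda>i. Q i - P i)
        + winner \<rho> H (\<lambda>i. P i - Q i) (\<lambda>i. P i - Q i)"
    by (simp add: winner_expand winner_commute[of _ _ Q P]
        winner_commute[of _ _ N P] winner_commute[of _ _ N Q] algebra_simps)
  then have "winner \<rho> H (\<lambda>i. P i - Q i) (\<lambda>i. P i - Q i)
      \<le> winner \<rho> H (\<lambda>i. N i - Q i) (\<lambda>i. N i - Q i)"
    using wprojection_variational[OF assms] winner_self_nonneg[of \<rho> H "\<lambda>i. N i - P i"] by linarith
  then show ?thesis
    by (simp add: wnorm_def)
qed

text \<open>The squared distance to Q is a potential: each step lowers it by at least twice the step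
  size times the regret of the round, up to a term quadratic in the step size. The sum telescopes,
  and the start at 0 makes the initial potential at most R^2.\<close>

lemma projected_subgradient_regret:
  assumes M1: "M 1 = (\<lambda>i. 0)"
    and sub: "\<And>t. t \<in> {1..T} \<Longrightarrow> is_wsubgradient \<rho> H (f t) (M t) (g t)"
    and proj: "\<And>t. t \<in> {1..T} \<Longrightarrow> is_wprojection \<rho> H R (\<lambda>i. M t i - \<eta> *\<^sub>R g t i) (M (Suc t))"
    and g: "\<And>t. t \<in> {1..T} \<Longrightarrow> wnorm \<rho> H (g t) \<le> G"
    and Q: "wnorm \<rho> H Q \<le> R" and \<eta>: "\<eta> > 0"
  shows "(\<Sum>t = 1..T. f t (M t) - f t Q) \<le> R\<^sup>2 / (2 * \<eta>) + \<eta> * real T * G\<^sup>2 / 2"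
proof -
  let ?d = "\<lambda>t. winner \<rho> H (\<lambda>i. M t i - Q i) (\<lambda>i. M t i - Q i)"
  have step: "2 * \<eta> * (f t (M t) - f t Q) \<le> ?d t - ?d (Suc t) + \<eta>\<^sup>2 * G\<^sup>2" if t: "t \<in> {1..T}" for t
  proof -
    have "f t (M t) - f t Q \<le> winner \<rho> H (g t) (\<lambda>i. M t i - Q i)"
      using sub[OF t, unfolded is_wsubgradient_def, rule_format, of Q]
      by (simp add: winner_expand)
    then have "2 * \<eta> * (f t (M t) - f t Q) \<le> 2 * \<eta> * winner \<rho> H (g t) (\<lambda>i. M t i - Q i)"
      using \<eta> by simp
    also have "\<dots> = ?d t + \<eta>\<^sup>2 * winner \<rho> H (g t) (g t)
        - winner \<rho> H (\<lambda>i. M t i - \<eta> *\<^sub>R g t i - Q i) (\<lambda>i. M t i - \<eta> *\<^sub>R g t i - Q i)"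
      by (simp add: winner_expand winner_commute[of _ _ "g t" "M t"] winner_commute[of _ _ "g t" Q]
          winner_commute[of _ _ Q "M t"] power2_eq_square algebra_simps)
    also have "\<dots> \<le> ?d t + \<eta>\<^sup>2 * G\<^sup>2 - ?d (Suc t)"
    proof (intro diff_mono add_mono mult_left_mono)
      show "winner \<rho> H (g t) (g t) \<le> G\<^sup>2"
        using g[OF t] wnorm_le_iff wnorm_nonneg order_trans by meson
      show "?d (Suc t)
          \<le> winner \<rho> H (\<lambda>i. M t i - \<eta> *\<^sub>R g t i - Q i) (\<lambda>i. M t i - \<eta> *\<^sub>R g t i - Q i)"
        using wprojection_dist_le[OF proj[OF t] Q] by (simp add: wnorm_def)
    qed auto
    finally show ?thesis
      by simp
  qed
  have "2 * \<eta> * (\<Sum>t = 1..T. f t (M t) - f t Q) \<le> (\<Sum>t = 1..T. ?d t - ?d (Suc t) + \<eta>\<^sup>2 * G\<^sup>2)"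
    unfolding sum_distrib_left by (intro sum_mono step)
  also have "\<dots> = (\<Sum>t = 1..T. ?d t - ?d (Suc t)) + real T * (\<eta>\<^sup>2 * G\<^sup>2)"
    by (simp only: sum.distrib) simp
  also have "(\<Sum>t = 1..T. ?d t - ?d (Suc t)) = ?d 1 - ?d (Suc T)"
    by (induction T) auto
  also have "?d 1 = winner \<rho> H Q Q"
    using M1 winner_scale_left[of \<rho> H "-1" Q] winner_scale_right[of \<rho> H _ "-1" Q] by simp
  also have "winner \<rho> H Q Q - ?d (Suc T) + real T * (\<eta>\<^sup>2 * G\<^sup>2) \<le> R\<^sup>2 + real T * (\<eta>\<^sup>2 * G\<^sup>2)"
    using Q wnorm_le_iff[of R \<rho> H Q] winner_self_nonneg[of \<rho> H "\<lambda>i. M (Suc T) i - Q i"]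
      order_trans[OF wnorm_nonneg Q] by linarith
  finally show ?thesis
    using \<eta> by (simp add: field_simps power2_eq_square)
qed

text \<open>Applied with a = L W S and q = sqrt T, where the prescribed step size makes both
  summands equal to half of the result.\<close>

lemma step_size_balance:
  fixes a \<psi> q R :: real
  assumes "a > 0" "\<psi> > 0" "q > 0" "R > 0" "\<eta> = R / (a * \<psi> * q)"
  shows "R\<^sup>2 / (2 * \<eta>) + \<eta> * q\<^sup>2 * (a\<^sup>2 * \<psi>\<^sup>2) / 2 = R * a * \<psi> * q"
proof -
  have "R\<^sup>2 / (2 * \<eta>) = R * a * \<psi> * q / 2"
    using assms by (simp add: power2_eq_square)
  moreover have "\<eta> * q\<^sup>2 * (a\<^sup>2 * \<psi>\<^sup>2) / 2 = R * a * \<psi> * q / 2"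
    using assms by (simp add: power2_eq_square)
  ultimately show ?thesis
    by simp
qed

text \<open>The subgradient inequality is tested in the direction g itself. A Lipschitz estimate at
  one nearby point suffices, so costs that are Lipschitz only on a ball are covered.\<close>

lemma wsubgradient_norm_le:
  assumes sub: "is_wsubgradient \<rho> H f M g" and s: "s > 0"
    and lip: "f (\<lambda>i. M i + s *\<^sub>R g i) - f M \<le> G * (s * wnorm \<rho> H g)" and G: "0 \<le> G"
  shows "wnorm \<rho> H g \<le> G"
proof (cases "wnorm \<rho> H g = 0")
  case False
  have "f M + winner \<rho> H g (\<lambda>i. s *\<^sub>R g i) \<le> f (\<lambda>i. M i + s *\<^sub>R g i)"
    using sub[unfolded is_wsubgradient_def, rule_format, of "\<lambda>i. M i + s *\<^sub>R g i"] by simp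
  then have "s * (wnorm \<rho> H g)\<^sup>2 \<le> G * (s * wnorm \<rho> H g)"
    using lip by (simp add: winner_scale_right wnorm_power2)
  then have "(s * wnorm \<rho> H g) * wnorm \<rho> H g \<le> (s * wnorm \<rho> H g) * G"
    by (simp add: power2_eq_square mult_ac)
  moreover have "s * wnorm \<rho> H g > 0"
    using s False wnorm_nonneg[of \<rho> H g] by (simp add: less_le)
  ultimately show ?thesis
    by (simp only: mult_le_cancel_left_pos)
qed (use G in simp)

text \<open>Cauchy-Schwarz after inserting \<rho>^(i-1) and its inverse.\<close>

lemma sum_norm_le_wnorm:
  assumes "\<rho> > 0"
  shows "(\<Sum>i = 1..H. norm (M i)) \<le> geo_S \<rho> H * wnorm \<rho> H M"
proof -
  have "(\<Sum>i = 1..H. norm (M i)) = (\<Sum>i = 1..H. \<bar>\<rho> ^ (i - 1)\<bar> * \<bar>inverse (\<rho> ^ (i - 1)) * norm (M i)\<bar>)"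
    using assms by (intro sum.cong) (auto simp: abs_mult)
  also have "\<dots> \<le> L2_set (\<lambda>i. \<rho> ^ (i - 1)) {1..H} * L2_set (\<lambda>i. inverse (\<rho> ^ (i - 1)) * norm (M i)) {1..H}"
    by (rule L2_set_mult_ineq)
  also have "L2_set (\<lambda>i. \<rho> ^ (i - 1)) {1..H} = geo_S \<rho> H"
    by (simp add: L2_set_def geo_S_def mult.commute flip: power_mult)
  also have "L2_set (\<lambda>i. inverse (\<rho> ^ (i - 1)) * norm (M i)) {1..H} = wnorm \<rho> H M"
    by (simp add: L2_set_def wnorm_def winner_def power_mult_distrib power2_norm_eq_inner
        power_inverse mult.commute[of _ 2] flip: power_mult)
  finally show ?thesis .
qed


subsection \<open>Responses of the stabilized plant\<close>

text \<open>Variation of constants. Time starts at 1, so there are t - 1 terms, and the one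
  propagated r times stems from time t - 1 - r.\<close>

lemma linear_recurrence_solution:
  fixes F :: "real ^ 'n ^ 'n"
  assumes "x 1 = 0" "t \<ge> 1" "\<And>s. s \<in> {1..<t} \<Longrightarrow> x (Suc s) = F *v x s + d s"
  shows "x t = (\<Sum>r<t - 1. mpow F r *v d (t - 1 - r))"
  using assms(2,3)
proof (induction t rule: dec_induct)
  case (step t)
  then have "x (Suc t) = F *v (\<Sum>r<t - 1. mpow F r *v d (t - 1 - r)) + d t"
    by simp
  also have "F *v (\<Sum>r<t - 1. mpow F r *v d (t - 1 - r))
      = (\<Sum>r<t - 1. mpow F (Suc r) *v d (t - Suc r))"
    by (simp add: linear_sum[of "(*v) F"] matrix_vector_mul_assoc comp_def)
  also have "\<dots> + d t = (\<Sum>r<Suc (t - 1). mpow F r *v d (t - r))"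
    by (simp add: sum.lessThan_Suc_shift del: sum.lessThan_Suc)
  finally show ?case
    using step by simp
qed (use assms(1) in simp)

text \<open>Stated for a family of linear maps so that it serves both tracker series: F^r followed
  by x |-> (x, -K0 x) for \<open>Lam\<close>, and F^r B for \<open>LamB\<close>.\<close>

lemma norm_sum_matrix_response_le:
  fixes f :: "nat \<Rightarrow> 'a::real_normed_vector \<Rightarrow> 'b::real_normed_vector"
  assumes bl: "\<And>r. bounded_linear (f r)" and sm: "summable (\<lambda>r. onorm (f r))"
    and d: "\<And>r. r < n \<Longrightarrow> norm (d r) \<le> \<delta>" and \<delta>: "0 \<le> \<delta>"
  shows "norm (\<Sum>r<n. f r (d r)) \<le> (\<Sum>r. onorm (f r)) * \<delta>"
proof -
  have "norm (\<Sum>r<n. f r (d r)) \<le> (\<Sum>r<n. onorm (f r) * \<delta>)"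
    by (rule sum_norm_le, rule order_trans[OF onorm[OF bl]])
      (use d bl in \<open>auto intro!: mult_left_mono onorm_pos_le\<close>)
  also have "\<dots> \<le> (\<Sum>r. onorm (f r)) * \<delta>"
    unfolding sum_distrib_right[symmetric]
    using sm bl \<delta> by (intro mult_right_mono sum_le_suminf) (auto intro: onorm_pos_le)
  finally show ?thesis .
qed

section \<open>Tracker quantities and responses of the plant under the feedback K0\<close>

locale stable_tracker =
  fixes A :: "real ^ 'x ^ 'x" and B :: "real ^ 'u ^ 'x" and K0 :: "real ^ 'x ^ 'u"
  assumes stable: "schur_stable (A - B ** K0)"
begin

abbreviation "F \<equiv> A - B ** K0"
abbreviation "\<Lambda> \<equiv> Lam A B K0"
abbreviation "\<Lambda>\<^sub>B \<equiv> LamB A B K0"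
abbreviation "c\<^sub>0 \<equiv> C0 A B K0"
abbreviation "\<psi>\<^sub>0 \<equiv> Psi0 A B K0"

abbreviation feedback :: "real ^ 'x \<Rightarrow> (real ^ 'x) \<times> (real ^ 'u)" where
  "feedback x \<equiv> (x, - (K0 *v x))"

lemma feedback_linear: "bounded_linear (\<lambda>x. feedback (M *v x))"
  by (intro bounded_linear_Pair bounded_linear_minus matrix_vector_bounded_linear
      bounded_linear_compose[OF matrix_vector_bounded_linear])

lemma feedback_bound: "onorm (\<lambda>x. feedback (M *v x)) \<le> (1 + opnorm K0) * opnorm M"
proof (rule onorm_le)
  fix x
  have "norm (feedback (M *v x)) \<le> norm (M *v x) + norm (K0 *v (M *v x))"
    using norm_Pair_le[of "M *v x" "- (K0 *v (M *v x))"] by simp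
  also have "\<dots> \<le> norm (M *v x) + opnorm K0 * norm (M *v x)"
    by (intro add_left_mono norm_matrix_vector_le_opnorm)
  also have "\<dots> = (1 + opnorm K0) * norm (M *v x)"
    by (simp add: algebra_simps)
  also have "\<dots> \<le> (1 + opnorm K0) * (opnorm M * norm x)"
    by (intro mult_left_mono norm_matrix_vector_le_opnorm) auto
  finally show "norm (feedback (M *v x)) \<le> (1 + opnorm K0) * opnorm M * norm x"
    by (simp add: mult_ac)
qed

lemma summable_Lam: "summable (\<lambda>r. onorm (\<lambda>x. feedback (mpow F r *v x)))"
proof (rule summable_comparison_test)
  show "summable (\<lambda>r. (1 + opnorm K0) * opnorm (mpow F r))"
    by (intro summable_mult schur_stable_summable_opnorm stable)
qed (use feedback_bound in \<open>auto simp: onorm_pos_le feedback_linear\<close>)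

lemma summable_LamB: "summable (\<lambda>r. opnorm (mpow F r ** B))"
proof (rule summable_comparison_test)
  show "summable (\<lambda>r. opnorm (mpow F r) * opnorm B)"
    by (intro summable_mult2 schur_stable_summable_opnorm stable)
qed (use opnorm_matrix_mult_le in auto)

lemma LamB_nonneg: "\<Lambda>\<^sub>B \<ge> 0"
  unfolding LamB_def by (intro suminf_nonneg summable_LamB) simp

text \<open>The term r = 0 of the series is the norm of x |-> (x, -K0 x). Hence the size of K0 is
  controlled by the tracker quantities alone.\<close>

lemma opnorm_K0_le_Lam: "opnorm K0 \<le> \<Lambda>"
proof -
  have "opnorm K0 \<le> onorm (\<lambda>x. feedback (mpow F 0 *v x))"
  proof (rule onorm_le)
    fix x
    have "norm (K0 *v x) \<le> norm (feedback (mpow F 0 *v x))"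
      by (simp add: norm_Pair)
    also have "\<dots> \<le> onorm (\<lambda>x. feedback (mpow F 0 *v x)) * norm x"
      by (rule onorm[OF feedback_linear])
    finally show "norm (K0 *v x) \<le> onorm (\<lambda>x. feedback (mpow F 0 *v x)) * norm x" .
  qed
  also have "\<dots> = (\<Sum>r\<in>{0}. onorm (\<lambda>x. feedback (mpow F r *v x)))"
    by simp
  also have "\<dots> \<le> \<Lambda>"
    unfolding Lam_def by (rule sum_le_suminf[OF summable_Lam]) (auto simp: onorm_pos_le feedback_linear)
  finally show ?thesis .
qed

lemma Lam_nonneg: "\<Lambda> \<ge> 0"
  using opnorm_K0_le_Lam opnorm_nonneg order_trans by blast

lemma C0_ge_1: "c\<^sub>0 \<ge> 1"
proof -
  have "1 \<le> (1 + opnorm K0 * \<Lambda>\<^sub>B)\<^sup>2"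
    using LamB_nonneg by (simp add: one_le_power)
  then show ?thesis
    unfolding C0_def by (simp add: add_increasing)
qed

lemma Psi0_ge_C0: "\<psi>\<^sub>0 \<ge> c\<^sub>0"
  unfolding Psi0_def using C0_ge_1 Lam_nonneg LamB_nonneg by (intro real_le_rsqrt) auto

lemma Psi0_power2: "\<psi>\<^sub>0\<^sup>2 = c\<^sub>0\<^sup>2 + 2 * \<Lambda> * \<Lambda>\<^sub>B * c\<^sub>0"
  unfolding Psi0_def using C0_ge_1 Lam_nonneg LamB_nonneg by simp

lemma input_state_bound:
  assumes x: "x 1 = 0" "t \<ge> 1" "\<And>s. s \<in> {1..<t} \<Longrightarrow> x (Suc s) = F *v x s + B *v v s"
    and v: "\<And>s. s \<in> {1..<t} \<Longrightarrow> norm (v s) \<le> V" and V: "0 \<le> V"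
  shows "norm (x t) \<le> \<Lambda>\<^sub>B * V"
proof -
  have "x t = (\<Sum>r<t - 1. (mpow F r ** B) *v v (t - 1 - r))"
    by (subst linear_recurrence_solution[OF x]) (auto simp: matrix_vector_mul_assoc)
  also have "norm \<dots> \<le> \<Lambda>\<^sub>B * V"
    unfolding LamB_def by (rule norm_sum_matrix_response_le[where f = "\<lambda>r. (*v) (mpow F r ** B)"])
      (use v V summable_LamB in auto)
  finally show ?thesis .
qed

lemma disturbance_response_bound:
  assumes x: "x 1 = 0" "t \<ge> 1" "\<And>s. s \<in> {1..<t} \<Longrightarrow> x (Suc s) = F *v x s + d s"
    and d: "\<And>s. s \<in> {1..<t} \<Longrightarrow> norm (d s) \<le> \<delta>" and \<delta>: "0 \<le> \<delta>"
  shows "norm (feedback (x t)) \<le> \<Lambda> * \<delta>"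
proof -
  have "linear feedback"
    using feedback_linear[of "mat 1"] by (simp add: bounded_linear.linear)
  then have "feedback (\<Sum>r<t - 1. mpow F r *v d (t - 1 - r))
      = (\<Sum>r<t - 1. feedback (mpow F r *v d (t - 1 - r)))"
    by (rule linear_sum)
  then have "feedback (x t) = (\<Sum>r<t - 1. feedback (mpow F r *v d (t - 1 - r)))"
    by (simp only: linear_recurrence_solution[OF x])
  also have "norm \<dots> \<le> \<Lambda> * \<delta>"
    unfolding Lam_def
    by (rule norm_sum_matrix_response_le[where f = "\<lambda>r x. feedback (mpow F r *v x)"])
      (use d \<delta> summable_Lam feedback_linear in auto)
  finally show ?thesis .
qed

text \<open>Origin of \<open>C0\<close>: inputs of size V move the state by at most
  \<open>LamB\<close> V and the control by at most (1 + |K0| \<open>LamB\<close>) V, and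
  \<open>C0\<close> is the Euclidean norm of these two factors.\<close>

lemma input_response_bound:
  assumes x: "x 1 = 0" "t \<ge> 1" "\<And>s. s \<in> {1..<t} \<Longrightarrow> x (Suc s) = F *v x s + B *v v s"
    and v: "\<And>s. s \<in> {1..t} \<Longrightarrow> norm (v s) \<le> V"
  shows "norm (x t, - (K0 *v x t) + v t) \<le> c\<^sub>0 * V"
proof -
  have vt: "norm (v t) \<le> V"
    using v x(2) by simp
  then have V: "0 \<le> V"
    using norm_ge_zero order_trans by blast
  have nx: "norm (x t) \<le> \<Lambda>\<^sub>B * V"
    by (rule input_state_bound[OF x]) (use v V in auto)
  have "norm (- (K0 *v x t) + v t) \<le> norm (K0 *v x t) + norm (v t)"
    by (metis norm_minus_cancel norm_triangle_ineq)
  also have "\<dots> \<le> opnorm K0 * (\<Lambda>\<^sub>B * V) + V"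
    by (rule add_mono[OF order_trans[OF norm_matrix_vector_le_opnorm mult_left_mono[OF nx]] vt]) simp
  also have "\<dots> = (1 + opnorm K0 * \<Lambda>\<^sub>B) * V"
    by (simp add: algebra_simps)
  finally have "norm (- (K0 *v x t) + v t) \<le> (1 + opnorm K0 * \<Lambda>\<^sub>B) * V" .
  with nx have "norm (x t, - (K0 *v x t) + v t)
      \<le> sqrt ((\<Lambda>\<^sub>B * V)\<^sup>2 + ((1 + opnorm K0 * \<Lambda>\<^sub>B) * V)\<^sup>2)"
    unfolding norm_Pair by (intro real_sqrt_le_mono add_mono power_mono) auto
  also have "\<dots> = sqrt ((\<Lambda>\<^sub>B\<^sup>2 + (1 + opnorm K0 * \<Lambda>\<^sub>B)\<^sup>2) * V\<^sup>2)"
    by (simp only: power_mult_distrib distrib_right[of "_\<^sup>2"])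
  also have "\<dots> = c\<^sub>0 * V"
    using V by (simp add: C0_def real_sqrt_mult)
  finally show ?thesis .
qed

end

section \<open>Recursions of the trajectories and size of the response inputs\<close>

lemma ref_state_Suc:
  "t \<ge> 1 \<Longrightarrow> ref_state A B K0 H w M (Suc t)
    = (A - B ** K0) *v ref_state A B K0 H w M t + B *v resp H w M t + w t"
  by (cases t) auto

lemma state_Suc:
  "t \<ge> 1 \<Longrightarrow> state A B \<pi> w (Suc t)
    = A *v state A B \<pi> w t + B *v \<pi> t (state A B \<pi> w t) + w t"
  by (cases t) auto

lemma resp_diff: "resp H w (\<lambda>i. M i - N i) t = resp H w M t - resp H w N t"
  by (simp add: resp_def matrix_vector_mult_diff_rdistrib sum_subtractf)

lemma resp_bound:
  assumes "\<And>s. s \<in> {1..<t} \<Longrightarrow> norm (w s) \<le> W" and W: "0 \<le> W" and "\<rho> > 0"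
  shows "norm (resp H w M t) \<le> W * geo_S \<rho> H * wnorm \<rho> H M"
proof -
  have "norm (resp H w M t) \<le> (\<Sum>i = 1..H. norm (M i) * W)"
    unfolding resp_def
    by (rule sum_norm_le, rule order_trans[OF norm_matrix_vector_le])
      (use assms in \<open>auto intro!: mult_left_mono\<close>)
  also have "\<dots> \<le> (geo_S \<rho> H * wnorm \<rho> H M) * W"
    unfolding sum_distrib_right[symmetric]
    by (intro mult_right_mono sum_norm_le_wnorm assms)
  finally show ?thesis
    by (simp add: mult_ac)
qed

lemma geo_S_le:
  assumes "0 < \<gamma>" "\<gamma> < 1"
  shows "geo_S (sqrt (1 - \<gamma>)) H \<le> 1 / sqrt \<gamma>"
proof -
  have "(\<Sum>i = 1..H. sqrt (1 - \<gamma>) ^ (2 * (i - 1))) = (\<Sum>i<H. (1 - \<gamma>) ^ i)"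
    using assms by (simp add: power_mult sum.atLeast1_atMost_eq)
  also have "\<dots> \<le> 1 / \<gamma>"
    using assms by (simp add: sum_gp_strict divide_right_mono)
  finally show ?thesis
    unfolding geo_S_def using real_sqrt_le_mono by (fastforce simp: real_sqrt_divide)
qed

lemma geo_S_nonneg [simp]: "geo_S \<rho> H \<ge> 0"
  by (auto simp: geo_S_def power_mult intro!: sum_nonneg)

lemma geo_S_pos: "H \<ge> 1 \<Longrightarrow> \<rho> > 0 \<Longrightarrow> geo_S \<rho> H > 0"
  unfolding geo_S_def by (intro real_sqrt_gt_zero sum_pos) auto


subsection \<open>Physical and reference trajectories\<close>

lemma sum_geometric_tail_le:
  fixes q :: real
  assumes "0 \<le> q" "q < 1"
  shows "(\<Sum>r = m..<n. q ^ r) \<le> q ^ m / (1 - q)"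
proof (cases "m \<le> n")
  case True
  then have "(1 - q) * (\<Sum>r = m..<n. q ^ r) = q ^ m - q ^ n"
  proof (induction n rule: dec_induct)
    case (step n)
    show ?case
      by (simp only: sum.atLeastLessThan_Suc[OF step.hyps(1)] distrib_left step.IH)
        (simp add: algebra_simps)
  qed simp
  also have "\<dots> \<le> q ^ m"
    using assms by simp
  finally show ?thesis
    using assms by (simp add: pos_le_divide_eq mult.commute)
qed (use assms in simp)

locale weighted_response = stable_tracker A B K0
  for A :: "real ^ 'x ^ 'x" and B :: "real ^ 'u ^ 'x" and K0 :: "real ^ 'x ^ 'u" +
  fixes \<kappa> \<gamma> W :: real and T :: nat and w :: "nat \<Rightarrow> real ^ 'x"
  assumes \<kappa>: "\<kappa> \<ge> 1" and \<gamma>: "0 < \<gamma>" "\<gamma> < 1" and T: "T \<ge> 1" and W: "W \<ge> 0"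
    and nonempty: "policy_class A B \<kappa> \<gamma> \<noteq> {}"
    and w: "\<And>t. t \<in> {1..T} \<Longrightarrow> norm (w t) \<le> W"
begin

abbreviation "\<rho> \<equiv> sqrt (1 - \<gamma>)"
abbreviation "H \<equiv> trunc_len A B K0 \<gamma> T"
abbreviation "R \<equiv> resp_radius A B K0 \<kappa> \<gamma>"
abbreviation "S \<equiv> geo_S \<rho> H"
abbreviation "\<Delta> \<equiv> (SUP K \<in> policy_class A B \<kappa> \<gamma>. norm (K - K0))"
abbreviation "ref \<equiv> ref_traj A B K0 H w"
abbreviation "lin K \<equiv> lin_traj A B K w"
abbreviation "phys \<equiv> phys_traj A B K0 H w"

lemma \<rho>_pos: "\<rho> > 0"
  using \<gamma> by simp

text \<open>Besides its value, the bound makes the set of distances bounded above, so that the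
  supremum in \<open>resp_radius\<close> is a genuine one.\<close>

lemma policy_dist_le:
  assumes "K \<in> policy_class A B \<kappa> \<gamma>"
  shows "norm (K - K0) \<le> sqrt (real CARD('x)) * (\<kappa> + opnorm K0)"
proof -
  have "opnorm (K - K0) \<le> opnorm K + opnorm K0"
  proof (rule onorm_le)
    fix x
    have "norm ((K - K0) *v x) \<le> norm (K *v x) + norm (K0 *v x)"
      by (simp add: matrix_vector_mult_diff_rdistrib norm_triangle_ineq4)
    also have "\<dots> \<le> opnorm K * norm x + opnorm K0 * norm x"
      by (intro add_mono norm_matrix_vector_le_opnorm)
    finally show "norm ((K - K0) *v x) \<le> (opnorm K + opnorm K0) * norm x"
      by (simp add: algebra_simps)
  qed
  also have "\<dots> \<le> \<kappa> + opnorm K0"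
    using assms by (simp add: policy_class_def)
  finally show ?thesis
    by (intro order_trans[OF norm_le_sqrt_card_opnorm] mult_left_mono) auto
qed

lemma norm_policy_diff_le_Sup:
  assumes "K \<in> policy_class A B \<kappa> \<gamma>"
  shows "norm (K - K0) \<le> \<Delta>"
proof (rule cSUP_upper[OF assms])
  show "bdd_above ((\<lambda>K. norm (K - K0)) ` policy_class A B \<kappa> \<gamma>)"
    by (rule bdd_aboveI2) (rule policy_dist_le)
qed

lemma \<Delta>_nonneg: "0 \<le> \<Delta>"
  using nonempty norm_policy_diff_le_Sup norm_ge_zero order_trans by blast

lemma \<Delta>_le: "\<Delta> \<le> sqrt (real CARD('x)) * (\<kappa> + opnorm K0)"
  by (rule cSUP_least[OF nonempty policy_dist_le])

lemma R_nonneg: "0 \<le> R"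
  unfolding resp_radius_def using \<Delta>_nonneg \<gamma> by simp

text \<open>The gain of the weighting: \<open>geo_S\<close> and \<open>resp_radius\<close> each
  contribute \<gamma>^(-1/2), so their product costs only one factor 1/\<gamma>.\<close>

lemma S_R_le: "S * R \<le> \<kappa>\<^sup>2 * \<Delta> / \<gamma>"
proof -
  have "S * R \<le> (1 / sqrt \<gamma>) * R"
    by (intro mult_right_mono geo_S_le \<gamma> R_nonneg)
  also have "\<dots> = \<kappa>\<^sup>2 * \<Delta> / (sqrt \<gamma> * sqrt \<gamma>)"
    by (simp add: resp_radius_def)
  finally show ?thesis
    using \<gamma> by simp
qed

lemma resp_le:
  assumes "t \<in> {1..T}"
  shows "norm (resp H w M t) \<le> W * S * wnorm \<rho> H M"
  using assms w W \<rho>_pos by (intro resp_bound) auto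

text \<open>The disturbances cancel in the difference of two reference trajectories, which is driven
  by the difference of the inputs alone.\<close>

lemma ref_diff_le:
  assumes t: "t \<in> {1..T}"
  shows "norm (ref N t - ref M t) \<le> c\<^sub>0 * (W * S * wnorm \<rho> H (\<lambda>i. N i - M i))"
proof -
  let ?x = "\<lambda>s. ref_state A B K0 H w N s - ref_state A B K0 H w M s"
  let ?v = "\<lambda>s. resp H w (\<lambda>i. N i - M i) s"
  have "ref N t - ref M t = (?x t, - (K0 *v ?x t) + ?v t)"
    by (simp add: ref_traj_def resp_diff matrix_vector_mult_diff_distrib)
  also have "norm \<dots> \<le> c\<^sub>0 * (W * S * wnorm \<rho> H (\<lambda>i. N i - M i))"
  proof (rule input_response_bound)
    show "?x (Suc s) = F *v ?x s + B *v ?v s" if "s \<in> {1..<t}" for s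
      using that by (simp add: ref_state_Suc resp_diff matrix_vector_mult_diff_distrib)
    show "norm (?v s) \<le> W * S * wnorm \<rho> H (\<lambda>i. N i - M i)" if "s \<in> {1..t}" for s
      using that t by (intro resp_le) auto
  qed (use t in auto)
  finally show ?thesis .
qed

lemma phys_state_Suc:
  assumes "s \<ge> 1"
  shows "fst (phys M (Suc s)) = F *v fst (phys M s) + B *v resp H w (M s) s + w s"
  using assms
  by (simp add: phys_traj_def traj_def state_Suc matrix_vector_mult_diff_rdistrib
      matrix_vector_mult_diff_distrib matrix_vector_right_distrib vec.neg flip: matrix_vector_mul_assoc)

text \<open>
  The physical and reference states differ by the response of the plant to the jumps of the
  reference state that the parameter updates cause.
\<close>

lemma phys_ref_dist_le:
  assumes t: "t \<in> {1..T}" and \<delta>: "0 \<le> \<delta>"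
    and step: "\<And>s. s \<in> {1..<t} \<Longrightarrow> wnorm \<rho> H (\<lambda>i. M (Suc s) i - M s i) \<le> \<delta>"
  shows "norm (phys M t - ref (M t) t) \<le> \<Lambda> * (\<Lambda>\<^sub>B * (W * S * \<delta>))"
proof -
  let ?x = "\<lambda>s. fst (phys M s) - ref_state A B K0 H w (M s) s"
  let ?d = "\<lambda>s. ref_state A B K0 H w (M s) (Suc s) - ref_state A B K0 H w (M (Suc s)) (Suc s)"
  have "phys M t - ref (M t) t = feedback (?x t)"
    by (simp add: ref_traj_def phys_traj_def traj_def matrix_vector_mult_diff_distrib)
  also have "norm \<dots> \<le> \<Lambda> * (\<Lambda>\<^sub>B * (W * S * \<delta>))"
  proof (rule disturbance_response_bound)
    show "?x (Suc s) = F *v ?x s + ?d s" if "s \<in> {1..<t}" for s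
      using that by (simp add: phys_state_Suc ref_state_Suc[of s _ _ _ _ _ "M s"]
          matrix_vector_mult_diff_distrib)
    show "norm (?d s) \<le> \<Lambda>\<^sub>B * (W * S * \<delta>)" if s: "s \<in> {1..<t}" for s
    proof -
      \<comment> \<open>Both reference trajectories run from time 1 with fixed parameters, so the
        jump is itself a plant response, to the input with parameter difference
        \<open>M s - M (Suc s)\<close>.\<close>
      let ?v = "\<lambda>r. resp H w (\<lambda>i. M s i - M (Suc s) i) r"
      let ?z = "\<lambda>r. ref_state A B K0 H w (M s) r - ref_state A B K0 H w (M (Suc s)) r"
      have z: "?z (Suc r) = F *v ?z r + B *v ?v r" if "r \<in> {1..<Suc s}" for r
        using that by (simp add: ref_state_Suc resp_diff matrix_vector_mult_diff_distrib)
      have v: "norm (?v r) \<le> W * S * \<delta>" if "r \<in> {1..<Suc s}" for r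
      proof -
        have "norm (?v r) \<le> W * S * wnorm \<rho> H (\<lambda>i. M s i - M (Suc s) i)"
          using that s t by (intro resp_le) auto
        also have "\<dots> \<le> W * S * \<delta>"
          using step[OF s] W wnorm_diff_commute[of \<rho> H "M s" "M (Suc s)"]
          by (intro mult_left_mono) auto
        finally show ?thesis .
      qed
      show ?thesis
        by (rule input_state_bound[where x = ?z and t = "Suc s" and v = ?v, OF _ _ z v])
          (use \<delta> W in auto)
    qed
  qed (use t \<delta> W LamB_nonneg in \<open>auto simp: phys_traj_def traj_def\<close>)
  finally show ?thesis .
qed

lemma ref_zero_le:
  assumes t: "t \<in> {1..T}"
  shows "norm (ref (\<lambda>i. 0) t) \<le> \<Lambda> * W"
proof -
  let ?x = "ref_state A B K0 H w (\<lambda>i. 0)"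
  have r0: "resp H w (\<lambda>i. 0) s = 0" for s
    by (simp add: resp_def)
  have "ref (\<lambda>i. 0) t = feedback (?x t)"
    by (simp add: ref_traj_def r0)
  also have "norm \<dots> \<le> \<Lambda> * W"
    by (rule disturbance_response_bound[where d = w]) (use t w W in \<open>auto simp: ref_state_Suc r0\<close>)
  finally show ?thesis .
qed

lemma ref_le:
  assumes t: "t \<in> {1..T}" and M: "wnorm \<rho> H M \<le> R"
  shows "norm (ref M t) \<le> \<Lambda> * W + c\<^sub>0 * (W * (S * R))"
proof -
  have "norm (ref M t) \<le> norm (ref (\<lambda>i. 0) t) + norm (ref M t - ref (\<lambda>i. 0) t)"
    by (rule norm_triangle_sub)
  also have "norm (ref M t - ref (\<lambda>i. 0) t) \<le> c\<^sub>0 * (W * S * wnorm \<rho> H M)"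
    using ref_diff_le[OF t, of M "\<lambda>i. 0"] by simp
  also have "\<dots> \<le> c\<^sub>0 * (W * S * R)"
    using C0_ge_1 W by (intro mult_left_mono M) auto
  finally show ?thesis
    using ref_zero_le[OF t] by (simp add: mult_ac)
qed

text \<open>Relative to the reference for zero parameters, the physical trajectory is driven by the
  inputs actually played, whose size the ball controls. The step size does not enter, so the radius
  is the same for every L.\<close>

lemma phys_le:
  assumes t: "t \<in> {1..T}" and M: "\<And>s. s \<in> {1..T} \<Longrightarrow> wnorm \<rho> H (M s) \<le> R"
  shows "norm (phys M t) \<le> \<Lambda> * W + c\<^sub>0 * (W * (S * R))"
proof -
  let ?x = "\<lambda>s. fst (phys M s) - ref_state A B K0 H w (\<lambda>i. 0) s"
  let ?v = "\<lambda>s. resp H w (M s) s"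
  have r0: "resp H w (\<lambda>i. 0) s = 0" for s
    by (simp add: resp_def)
  have "phys M t - ref (\<lambda>i. 0) t = (?x t, - (K0 *v ?x t) + ?v t)"
    by (simp add: ref_traj_def phys_traj_def traj_def matrix_vector_mult_diff_distrib r0)
  also have "norm \<dots> \<le> c\<^sub>0 * (W * (S * R))"
  proof (rule input_response_bound)
    show "?x (Suc s) = F *v ?x s + B *v ?v s" if "s \<in> {1..<t}" for s
      using that by (simp add: phys_state_Suc ref_state_Suc r0 matrix_vector_mult_diff_distrib)
    show "norm (?v s) \<le> W * (S * R)" if "s \<in> {1..t}" for s
    proof -
      have s: "s \<in> {1..T}"
        using that t by auto
      have "W * S * wnorm \<rho> H (M s) \<le> W * S * R"
        using W by (intro mult_left_mono M[OF s]) auto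
      then show ?thesis
        using resp_le[OF s, of "M s"] by (simp add: mult_ac)
    qed
  qed (use t in \<open>auto simp: phys_traj_def traj_def\<close>)
  finally show ?thesis
    using norm_triangle_sub[of "phys M t" "ref (\<lambda>i. 0) t"] ref_zero_le[OF t] by simp
qed


subsection \<open>Comparators\<close>

definition policy_blocks :: "real ^ 'x ^ 'u \<Rightarrow> ('x, 'u) blocks" where
  "policy_blocks K i = (K0 - K) ** mpow (A - B ** K) (i - 1)"

lemma policy_block_le:
  assumes K: "K \<in> policy_class A B \<kappa> \<gamma>"
  shows "norm (policy_blocks K i) \<le> \<Delta> * \<kappa>\<^sup>2 * (1 - \<gamma>) ^ (i - 1)"
proof -
  have "norm (policy_blocks K i) \<le> norm (K0 - K) * opnorm (mpow (A - B ** K) (i - 1))"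
    unfolding policy_blocks_def by (rule norm_matrix_mult_le)
  also have "\<dots> \<le> \<Delta> * (\<kappa>\<^sup>2 * (1 - \<gamma>) ^ (i - 1))"
    using K norm_policy_diff_le_Sup[OF K] \<Delta>_nonneg
    by (intro mult_mono) (auto simp: policy_class_def norm_minus_commute)
  finally show ?thesis
    by simp
qed

text \<open>The weight of block i cancels one of the two factors (1 - \<gamma>)^(i-1) in its squared
  norm. The remaining geometric series is at most 1/\<gamma>, which accounts for the \<gamma>^(-1/2)
  in the radius.\<close>

lemma policy_blocks_in_ball:
  assumes K: "K \<in> policy_class A B \<kappa> \<gamma>"
  shows "wnorm \<rho> H (policy_blocks K) \<le> R"
proof -
  let ?q = "1 - \<gamma>"
  have q: "0 < ?q" "?q < 1"
    using \<gamma> by auto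
  have "winner \<rho> H (policy_blocks K) (policy_blocks K)
      \<le> (\<Sum>i = 1..H. inverse (?q ^ (i - 1)) * (\<Delta> * \<kappa>\<^sup>2 * ?q ^ (i - 1))\<^sup>2)"
    unfolding winner_def power_mult
    using q by (intro sum_mono mult_mono)
      (auto simp flip: power2_norm_eq_inner intro!: power_mono policy_block_le[OF K, unfolded One_nat_def])
  also have "\<dots> = (\<Delta> * \<kappa>\<^sup>2)\<^sup>2 * (\<Sum>i = 1..H. ?q ^ (i - 1))"
  proof -
    have "inverse a * (\<Delta> * \<kappa>\<^sup>2 * a)\<^sup>2 = (\<Delta> * \<kappa>\<^sup>2)\<^sup>2 * a" if "a \<noteq> 0" for a :: real
      using that by (simp add: power2_eq_square)
    then show ?thesis
      using q by (simp add: sum_distrib_left)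
  qed
  also have "(\<Sum>i = 1..H. ?q ^ (i - 1)) = (\<Sum>r = 0..<H. ?q ^ r)"
    by (simp add: sum.atLeast1_atMost_eq atLeast0LessThan)
  also have "\<dots> \<le> 1 / \<gamma>"
    using sum_geometric_tail_le[of ?q 0 H] q by simp
  also have "(\<Delta> * \<kappa>\<^sup>2)\<^sup>2 * (1 / \<gamma>) = R\<^sup>2"
    using \<gamma> by (simp add: resp_radius_def power_mult_distrib power_divide mult_ac)
  finally show ?thesis
    using R_nonneg by (simp add: wnorm_le_iff mult_left_mono)
qed

lemma lin_state_eq:
  assumes "t \<ge> 1"
  shows "fst (lin K t) = (\<Sum>r<t - 1. mpow (A - B ** K) r *v w (t - 1 - r))"
proof (rule linear_recurrence_solution[OF _ assms])
  show "fst (lin K (Suc s)) = (A - B ** K) *v fst (lin K s) + w s" if "s \<in> {1..<t}" for s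
    using that by (simp add: lin_traj_def traj_def state_Suc matrix_vector_mult_diff_rdistrib
      vec.neg flip: matrix_vector_mul_assoc)
qed (simp add: lin_traj_def traj_def)

lemma lin_le:
  assumes K: "K \<in> policy_class A B \<kappa> \<gamma>" and t: "t \<in> {1..T}"
  shows "norm (lin K t) \<le> (1 + \<kappa>) * \<kappa>\<^sup>2 * W / \<gamma>"
proof -
  have "norm (fst (lin K t)) \<le> (\<Sum>r<t - 1. \<kappa>\<^sup>2 * (1 - \<gamma>) ^ r * W)"
  proof -
    have "norm (mpow (A - B ** K) r *v w (t - 1 - r)) \<le> \<kappa>\<^sup>2 * (1 - \<gamma>) ^ r * W"
      if "r < t - 1" for r
    proof -
      have "norm (w (t - 1 - r)) \<le> W"
        using that t by (intro w) auto
      then show ?thesis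
        using K W \<gamma> by (intro order_trans[OF norm_matrix_vector_le_opnorm] mult_mono)
          (auto simp: policy_class_def)
    qed
    then show ?thesis
      using t by (subst lin_state_eq) (auto intro!: sum_norm_le)
  qed
  also have "\<dots> = \<kappa>\<^sup>2 * W * (\<Sum>r = 0..<t - 1. (1 - \<gamma>) ^ r)"
    by (simp add: sum_distrib_left atLeast0LessThan mult_ac)
  also have "\<dots> \<le> \<kappa>\<^sup>2 * W * (1 / \<gamma>)"
    using sum_geometric_tail_le[of "1 - \<gamma>" 0 "t - 1"] \<gamma> W by (intro mult_left_mono) auto
  finally have x: "norm (fst (lin K t)) \<le> \<kappa>\<^sup>2 * W * (1 / \<gamma>)" .
  have "norm (K *v fst (lin K t)) \<le> \<kappa> * (\<kappa>\<^sup>2 * W * (1 / \<gamma>))"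
    using K x \<kappa> by (intro order_trans[OF norm_matrix_vector_le_opnorm] mult_mono)
      (auto simp: policy_class_def)
  moreover have "lin K t = (fst (lin K t), - (K *v fst (lin K t)))"
    by (simp add: lin_traj_def traj_def)
  then have "norm (lin K t) \<le> norm (fst (lin K t)) + norm (K *v fst (lin K t))"
    by (metis norm_Pair_le norm_minus_cancel)
  ultimately show ?thesis
    using x by (simp add: algebra_simps add_divide_distrib)
qed

lemma ref_policy_blocks_dist_le:
  assumes K: "K \<in> policy_class A B \<kappa> \<gamma>" and t: "t \<in> {1..T}"
  shows "norm (ref (policy_blocks K) t - lin K t) \<le> c\<^sub>0 * (\<Delta> * \<kappa>\<^sup>2 * W * ((1 - \<gamma>) ^ H / \<gamma>))"
proof -
  let ?x = "\<lambda>s. ref_state A B K0 H w (policy_blocks K) s - fst (lin K s)"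
  \<comment> \<open>Seen from the tracker, K feeds the input (K0 - K) x into the plant with matrix
    F; \<open>?v\<close> is the mismatch with the input that its blocks produce.\<close>
  let ?v = "\<lambda>s. resp H w (policy_blocks K) s - (K0 - K) *v fst (lin K s)"
  let ?g = "\<lambda>s r. policy_blocks K (Suc r) *v w (s - 1 - r)"
  have tail: "norm (?v s) \<le> \<Delta> * \<kappa>\<^sup>2 * W * ((1 - \<gamma>) ^ H / \<gamma>)" if s: "s \<in> {1..t}" for s
  proof -
    \<comment> \<open>With r = i - 1 the condition i < s becomes r < s - 1. The blocks thus
      reproduce the first H terms of the comparator's convolution, and the mismatch is the tail from
      H on.\<close>
    have "resp H w (policy_blocks K) s = (\<Sum>r<H. if r < s - 1 then ?g s r else 0)"
      unfolding resp_def One_nat_def sum.atLeast1_atMost_eq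
      by (intro sum.cong refl) (auto simp: less_diff_conv)
    also have "\<dots> = (\<Sum>r\<in>{..<H} \<inter> {..<s - 1}. ?g s r)"
      by (simp add: sum.If_cases lessThan_def)
    finally have 1: "resp H w (policy_blocks K) s = (\<Sum>r\<in>{..<H} \<inter> {..<s - 1}. ?g s r)" .
    have 2: "(K0 - K) *v fst (lin K s) = (\<Sum>r<s - 1. ?g s r)"
      using s by (simp add: lin_state_eq linear_sum[of "(*v) (K0 - K)"] policy_blocks_def
          matrix_vector_mul_assoc)
    have "(\<Sum>r<s - 1. ?g s r) = (\<Sum>r\<in>{..<H} \<inter> {..<s - 1}. ?g s r) + (\<Sum>r = H..<s - 1. ?g s r)"
      by (subst sum.union_disjoint[symmetric]) (auto intro!: sum.cong)
    then have "norm (?v s) = norm (\<Sum>r = H..<s - 1. ?g s r)"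
      unfolding 1 2 by simp
    also have "\<dots> \<le> (\<Sum>r = H..<s - 1. \<Delta> * \<kappa>\<^sup>2 * (1 - \<gamma>) ^ r * W)"
    proof (rule sum_norm_le)
      fix r assume r: "r \<in> {H..<s - 1}"
      have "norm (policy_blocks K (Suc r)) \<le> \<Delta> * \<kappa>\<^sup>2 * (1 - \<gamma>) ^ r"
        using policy_block_le[OF K, of "Suc r"] by simp
      moreover have "norm (w (s - 1 - r)) \<le> W"
        using r s t by (intro w) auto
      ultimately show "norm (?g s r) \<le> \<Delta> * \<kappa>\<^sup>2 * (1 - \<gamma>) ^ r * W"
        using \<Delta>_nonneg \<gamma> by (intro order_trans[OF norm_matrix_vector_le] mult_mono) auto
    qed
    also have "\<dots> = \<Delta> * \<kappa>\<^sup>2 * W * (\<Sum>r = H..<s - 1. (1 - \<gamma>) ^ r)"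
      by (simp add: sum_distrib_left mult_ac)
    also have "\<dots> \<le> \<Delta> * \<kappa>\<^sup>2 * W * ((1 - \<gamma>) ^ H / \<gamma>)"
      using sum_geometric_tail_le[of "1 - \<gamma>" H "s - 1"] \<gamma> W \<Delta>_nonneg by (intro mult_left_mono) auto
    finally show ?thesis .
  qed
  have "ref (policy_blocks K) t - lin K t = (?x t, - (K0 *v ?x t) + ?v t)"
    by (simp add: ref_traj_def lin_traj_def traj_def matrix_vector_mult_diff_distrib
        matrix_vector_mult_diff_rdistrib)
  also have "norm \<dots> \<le> c\<^sub>0 * (\<Delta> * \<kappa>\<^sup>2 * W * ((1 - \<gamma>) ^ H / \<gamma>))"
  proof (rule input_response_bound[OF _ _ _ tail])
    show "?x (Suc s) = F *v ?x s + B *v ?v s" if "s \<in> {1..<t}" for s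
      using that by (simp add: ref_state_Suc lin_traj_def traj_def state_Suc
          matrix_vector_mult_diff_distrib matrix_vector_mult_diff_rdistrib
          vec.neg flip: matrix_vector_mul_assoc)
  qed (use t in \<open>auto simp: lin_traj_def traj_def\<close>)
  finally show ?thesis .
qed

section \<open>Size of the truncation length and of the truncation error\<close>

lemma trunc_len_ge: "real H \<ge> 1 / \<gamma> * ln (2 + c\<^sub>0 * sqrt (real T) / \<psi>\<^sub>0)"
  unfolding trunc_len_def by (rule real_nat_ceiling_ge)

lemma log_arg_gt_2: "2 + c\<^sub>0 * sqrt (real T) / \<psi>\<^sub>0 > 2"
  using C0_ge_1 Psi0_ge_C0 T by simp

lemma trunc_len_pos: "H \<ge> 1"
proof -
  have "0 < 1 / \<gamma> * ln (2 + c\<^sub>0 * sqrt (real T) / \<psi>\<^sub>0)"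
    using \<gamma> log_arg_gt_2 by (intro mult_pos_pos ln_gt_zero) auto
  then show ?thesis
    using trunc_len_ge by linarith
qed

text \<open>Since \<open>C0\<close> is at most \<open>Psi0\<close>, the argument of the logarithm is
  at most 2 + sqrt T. The ceiling adds at most 1, which is below twice the bound without its
  constant because ln 2 exceeds 1/2; hence the 3.\<close>

lemma trunc_len_le: "real H \<le> 3 * (1 / \<gamma>) * ln (2 + real T / \<gamma>)"
proof -
  let ?z = "2 + c\<^sub>0 * sqrt (real T) / \<psi>\<^sub>0"
  have "c\<^sub>0 * sqrt (real T) / \<psi>\<^sub>0 \<le> 1 * sqrt (real T)"
    using C0_ge_1 Psi0_ge_C0 mult_right_mono[of "c\<^sub>0 / \<psi>\<^sub>0" 1 "sqrt (real T)"] by simp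
  also have "\<dots> \<le> real T"
    using T by (simp add: sqrt_le_D real_le_lsqrt power2_eq_square)
  also have "\<dots> \<le> real T / \<gamma>"
    using \<gamma> T by (simp add: field_simps)
  finally have "ln ?z \<le> ln (2 + real T / \<gamma>)"
    using log_arg_gt_2 by (subst ln_le_cancel_iff) auto
  then have l: "1 / \<gamma> * ln ?z \<le> 1 / \<gamma> * ln (2 + real T / \<gamma>)"
    using \<gamma> by (intro mult_left_mono) auto
  have "ln 2 \<le> ln (2 + real T / \<gamma>)"
    using \<gamma> by (subst ln_le_cancel_iff) (auto intro: add_pos_nonneg)
  then have "1 \<le> 2 * ln (2 + real T / \<gamma>)"
    using ln2_ge_two_thirds by linarith
  moreover have "1 * (2 * ln (2 + real T / \<gamma>)) \<le> 1 / \<gamma> * (2 * ln (2 + real T / \<gamma>))"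
    using \<gamma> calculation by (intro mult_right_mono) (auto simp: field_simps)
  ultimately have "1 \<le> 2 * (1 / \<gamma> * ln (2 + real T / \<gamma>))"
    by simp
  moreover have "real H \<le> 1 / \<gamma> * ln ?z + 1"
  proof -
    have "0 \<le> 1 / \<gamma> * ln ?z"
      using \<gamma> log_arg_gt_2 by simp
    then show ?thesis
      unfolding trunc_len_def by linarith
  qed
  ultimately show ?thesis
    using l by simp
qed

text \<open>As 1 - \<gamma> is at most exp (-\<gamma>), the power is at most the inverse of the
  argument of the logarithm, whose summand 2 is then dropped.\<close>

lemma truncation_factor_le: "(1 - \<gamma>) ^ H \<le> \<psi>\<^sub>0 / (c\<^sub>0 * sqrt (real T))"
proof -
  let ?z = "2 + c\<^sub>0 * sqrt (real T) / \<psi>\<^sub>0"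
  have "(1 - \<gamma>) ^ H \<le> exp (- \<gamma>) ^ H"
    using \<gamma> exp_ge_add_one_self[of "- \<gamma>"] by (intro power_mono) auto
  also have "\<dots> = exp (- (\<gamma> * real H))"
    by (simp add: exp_of_nat_mult[symmetric] mult.commute)
  also have "\<dots> \<le> exp (- ln ?z)"
    using trunc_len_ge \<gamma> by (simp add: field_simps)
  also have "\<dots> = 1 / ?z"
    using log_arg_gt_2 by (simp add: exp_minus inverse_eq_divide)
  also have "\<dots> \<le> 1 / (c\<^sub>0 * sqrt (real T) / \<psi>\<^sub>0)"
    using C0_ge_1 Psi0_ge_C0 T by (intro frac_le) auto
  finally show ?thesis
    by simp
qed

end


subsection \<open>Regret of the controller\<close>

lemma lipschitz_on_diff_le:
  fixes f :: "'a::real_normed_vector \<Rightarrow> real"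
  assumes "L-lipschitz_on X f" "x \<in> X" "y \<in> X"
  shows "f x - f y \<le> L * norm (x - y)"
  using lipschitz_onD[OF assms] unfolding dist_norm real_norm_def by linarith

context weighted_response
begin

lemma controller_runD:
  assumes "controller_run A B K0 \<kappa> \<gamma> T W L c w M"
  obtains \<eta> g where "L * W \<noteq> 0 \<longrightarrow> \<eta> = R / (L * W * S * \<psi>\<^sub>0 * sqrt (real T))"
    and "M 1 = (\<lambda>i. 0)"
    and "\<forall>t\<in>{1..T}. is_wsubgradient \<rho> H (\<lambda>N. c t (ref N t)) (M t) (g t)"
    and "\<forall>t\<in>{1..T}. is_wprojection \<rho> H R (\<lambda>i. M t i - \<eta> *\<^sub>R g t i) (M (Suc t))"
proof -
  obtain \<eta> where \<eta>: "L * W \<noteq> 0 \<longrightarrow> \<eta> = R / (L * W * S * \<psi>\<^sub>0 * sqrt (real T))"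
    and M1: "M 1 = (\<lambda>i. 0)"
    and ex: "\<forall>t\<in>{1..T}. \<exists>g. is_wsubgradient \<rho> H (\<lambda>N. c t (ref N t)) (M t) g
      \<and> is_wprojection \<rho> H R (\<lambda>i. M t i - \<eta> *\<^sub>R g i) (M (Suc t))"
    using assms unfolding controller_run_def Let_def by (elim exE conjE)
  from bchoice[OF ex] obtain g where g: "\<forall>t\<in>{1..T}. is_wsubgradient \<rho> H (\<lambda>N. c t (ref N t)) (M t) (g t)
      \<and> is_wprojection \<rho> H R (\<lambda>i. M t i - \<eta> *\<^sub>R g t i) (M (Suc t))" ..
  show thesis
    by (rule that[OF \<eta> M1, of g]) (use g in blast)+
qed

lemma iterate_in_ball:
  assumes run: "controller_run A B K0 \<kappa> \<gamma> T W L c w M" and t: "t \<in> {1..T}"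
  shows "wnorm \<rho> H (M t) \<le> R"
proof -
  obtain \<eta> g where "L * W \<noteq> 0 \<longrightarrow> \<eta> = R / (L * W * S * \<psi>\<^sub>0 * sqrt (real T))"
    and M1: "M 1 = (\<lambda>i. 0)"
    and "\<forall>t\<in>{1..T}. is_wsubgradient \<rho> H (\<lambda>N. c t (ref N t)) (M t) (g t)"
    and proj: "\<forall>t\<in>{1..T}. is_wprojection \<rho> H R (\<lambda>i. M t i - \<eta> *\<^sub>R g t i) (M (Suc t))"
    by (rule controller_runD[OF run])
  show ?thesis
  proof (cases "t = 1")
    case True
    then show ?thesis
      using M1 R_nonneg by simp
  next
    case False
    then have "t - 1 \<in> {1..T}" "Suc (t - 1) = t"
      using t by auto
    then show ?thesis
      using wprojection_in_ball[OF bspec[OF proj, of "t - 1"]] by simp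
  qed
qed

text \<open>The parameters move along g only so far that the reference point stays in X, where the
  cost is L-Lipschitz; the reference point itself is \<open>C0\<close> W S-Lipschitz in the
  parameters.\<close>

lemma subgradient_le:
  assumes t: "t \<in> {1..T}" and L: "0 \<le> L" and lip: "L-lipschitz_on X c"
    and int: "ref M t \<in> interior X"
    and sub: "is_wsubgradient \<rho> H (\<lambda>N. c (ref N t)) M g"
  shows "wnorm \<rho> H g \<le> L * (c\<^sub>0 * (W * S))"
proof -
  obtain e where e: "e > 0" "ball (ref M t) e \<subseteq> X"
    using int mem_interior by blast
  define b where "b = c\<^sub>0 * (W * S)"
  have b: "b \<ge> 0"
    using W C0_ge_1 by (simp add: b_def)
  \<comment> \<open>The added 1 keeps the displacement strictly below e and the denominator
    positive.\<close>
  define s where "s = e / (b * wnorm \<rho> H g + 1)"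
  have bg: "0 \<le> b * wnorm \<rho> H g"
    using b by simp
  then have s: "s > 0"
    using e by (simp add: s_def add_nonneg_pos)
  let ?N = "\<lambda>i. M i + s *\<^sub>R g i"
  have near: "norm (ref ?N t - ref M t) \<le> b * (s * wnorm \<rho> H g)"
    using ref_diff_le[OF t, of ?N M] s by (simp add: wnorm_scale b_def mult_ac)
  also have "\<dots> = e * ((b * wnorm \<rho> H g) / (b * wnorm \<rho> H g + 1))"
    by (simp add: s_def)
  also have "\<dots> < e * 1"
    using e bg by (intro mult_strict_left_mono) auto
  finally have "ref ?N t \<in> X"
    using e(2) by (auto simp: dist_norm norm_minus_commute)
  then have "c (ref ?N t) - c (ref M t) \<le> L * norm (ref ?N t - ref M t)"
    using int interior_subset by (intro lipschitz_on_diff_le[OF lip]) auto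
  also have "\<dots> \<le> L * (b * (s * wnorm \<rho> H g))"
    by (intro mult_left_mono near L)
  finally show ?thesis
    using b L s by (intro wsubgradient_norm_le[OF sub s]) (auto simp: b_def mult_ac)
qed

lemma descent_and_tracking_le:
  assumes run: "controller_run A B K0 \<kappa> \<gamma> T W L c w M" and L: "L > 0" and W_pos: "W > 0"
    and lip: "\<And>t. t \<in> {1..T} \<Longrightarrow> L-lipschitz_on X (c t)"
    and phys: "\<And>t. t \<in> {1..T} \<Longrightarrow> phys M t \<in> X"
    and int: "\<And>t N. t \<in> {1..T} \<Longrightarrow> wnorm \<rho> H N \<le> R \<Longrightarrow> ref N t \<in> interior X"
    and Q: "wnorm \<rho> H Q \<le> R"
  shows "(\<Sum>t = 1..T. c t (phys M t) - c t (ref Q t)) \<le> R * (L * W * S) * \<psi>\<^sub>0 * sqrt (real T)"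
proof -
  obtain \<eta> g where "L * W \<noteq> 0 \<longrightarrow> \<eta> = R / (L * W * S * \<psi>\<^sub>0 * sqrt (real T))"
    and M1: "M 1 = (\<lambda>i. 0)"
    and sub: "\<forall>t\<in>{1..T}. is_wsubgradient \<rho> H (\<lambda>N. c t (ref N t)) (M t) (g t)"
    and proj: "\<forall>t\<in>{1..T}. is_wprojection \<rho> H R (\<lambda>i. M t i - \<eta> *\<^sub>R g t i) (M (Suc t))"
    by (rule controller_runD[OF run])
  define a where "a = L * W * S"
  have a: "a > 0"
    using L W_pos geo_S_pos[OF trunc_len_pos \<rho>_pos] by (simp add: a_def)
  have \<eta>: "\<eta> = R / (a * \<psi>\<^sub>0 * sqrt (real T))"
    using \<open>L * W \<noteq> 0 \<longrightarrow> _\<close> L W_pos by (simp add: a_def)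
  have \<psi>: "\<psi>\<^sub>0 > 0"
    using C0_ge_1 Psi0_ge_C0 by linarith
  have \<eta>_nonneg: "\<eta> \<ge> 0"
    using R_nonneg a \<psi> by (simp add: \<eta>)
  have g: "wnorm \<rho> H (g t) \<le> a * c\<^sub>0" if t: "t \<in> {1..T}" for t
    using subgradient_le[OF t _ lip[OF t] int[OF t iterate_in_ball[OF run t]] bspec[OF sub t]] L
    by (simp add: a_def mult_ac)
  have move: "wnorm \<rho> H (\<lambda>i. M (Suc t) i - M t i) \<le> \<eta> * (a * c\<^sub>0)" if t: "t \<in> {1..T}" for t
  proof -
    have "wnorm \<rho> H (\<lambda>i. M (Suc t) i - M t i) \<le> wnorm \<rho> H (\<lambda>i. M t i - \<eta> *\<^sub>R g t i - M t i)"
      by (rule wprojection_dist_le[OF bspec[OF proj t] iterate_in_ball[OF run t]])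
    also have "\<dots> = \<eta> * wnorm \<rho> H (g t)"
      using wnorm_scale[of \<rho> H "- \<eta>" "g t"] \<eta>_nonneg by simp
    also have "\<dots> \<le> \<eta> * (a * c\<^sub>0)"
      by (intro mult_left_mono g t \<eta>_nonneg)
    finally show ?thesis .
  qed
  have refX: "ref N t \<in> X" if "t \<in> {1..T}" "wnorm \<rho> H N \<le> R" for N t
    using int[OF that] interior_subset by blast
  \<comment> \<open>Summed over T rounds and added to the quadratic term of the descent bound, this
    supplies exactly the second summand of \<open>Psi0\<close>^2.\<close>
  have track: "c t (phys M t) - c t (ref (M t) t) \<le> \<eta> * a\<^sup>2 * (\<Lambda> * \<Lambda>\<^sub>B * c\<^sub>0)" if t: "t \<in> {1..T}" for t
  proof -
    have "c t (phys M t) - c t (ref (M t) t) \<le> L * norm (phys M t - ref (M t) t)"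
      by (intro lipschitz_on_diff_le[OF lip[OF t]] phys refX t iterate_in_ball[OF run])
    also have "\<dots> \<le> L * (\<Lambda> * (\<Lambda>\<^sub>B * (W * S * (\<eta> * (a * c\<^sub>0)))))"
      using t L \<eta>_nonneg a C0_ge_1 by (intro mult_left_mono phys_ref_dist_le move) auto
    also have "\<dots> = \<eta> * a\<^sup>2 * (\<Lambda> * \<Lambda>\<^sub>B * c\<^sub>0)"
      by (simp add: a_def power2_eq_square)
    finally show ?thesis .
  qed
  have "(\<Sum>t = 1..T. c t (phys M t) - c t (ref Q t))
      = (\<Sum>t = 1..T. c t (phys M t) - c t (ref (M t) t)) + (\<Sum>t = 1..T. c t (ref (M t) t) - c t (ref Q t))"
    by (simp flip: sum.distrib)
  also have "(\<Sum>t = 1..T. c t (phys M t) - c t (ref (M t) t)) \<le> real T * (\<eta> * a\<^sup>2 * (\<Lambda> * \<Lambda>\<^sub>B * c\<^sub>0))"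
    using sum_bounded_above[of "{1..T}", OF track] by simp
  finally have split: "(\<Sum>t = 1..T. c t (phys M t) - c t (ref Q t)) \<le> real T * (\<eta> * a\<^sup>2 * (\<Lambda> * \<Lambda>\<^sub>B * c\<^sub>0))
      + (\<Sum>t = 1..T. c t (ref (M t) t) - c t (ref Q t))"
    by simp
  show ?thesis
  proof (cases "R = 0")
    case True
    have "c t (ref (M t) t) - c t (ref Q t) \<le> 0" if t: "t \<in> {1..T}" for t
    proof -
      have "wnorm \<rho> H (M t) = 0" "wnorm \<rho> H Q = 0"
        using iterate_in_ball[OF run t] Q True by (simp_all add: antisym)
      then have "norm (ref (M t) t - ref Q t) \<le> 0"
        using ref_diff_le[OF t, of "M t" Q] by (simp add: wnorm_diff_eq_0)
      then show ?thesis
        using lipschitz_on_diff_le[OF lip[OF t] refX[OF t iterate_in_ball[OF run t]] refX[OF t Q]]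
        by simp
    qed
    then have "(\<Sum>t = 1..T. c t (ref (M t) t) - c t (ref Q t)) \<le> 0"
      by (rule sum_nonpos)
    then show ?thesis
      using split True \<eta> by simp
  next
    case False
    then have R: "R > 0"
      using R_nonneg by simp
    then have "\<eta> > 0"
      using a \<psi> T by (simp add: \<eta>)
    then have "(\<Sum>t = 1..T. c t (ref (M t) t) - c t (ref Q t))
        \<le> R\<^sup>2 / (2 * \<eta>) + \<eta> * real T * (a * c\<^sub>0)\<^sup>2 / 2"
      by (intro projected_subgradient_regret[where g = g, OF M1 bspec[OF sub] bspec[OF proj] g Q])
    with split have "(\<Sum>t = 1..T. c t (phys M t) - c t (ref Q t))
        \<le> R\<^sup>2 / (2 * \<eta>) + \<eta> * (sqrt (real T))\<^sup>2 * (a\<^sup>2 * \<psi>\<^sub>0\<^sup>2) / 2"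
      by (simp add: Psi0_power2 power_mult_distrib algebra_simps add_divide_distrib)
    also have "\<dots> = R * a * \<psi>\<^sub>0 * sqrt (real T)"
      using a \<psi> T R by (intro step_size_balance[OF _ _ _ _ \<eta>]) auto
    finally show ?thesis
      by (simp add: a_def)
  qed
qed

text \<open>
  The set \<open>X\<close> is the whole space for globally Lipschitz costs and a ball for regular costs; the
  interior only serves to bound the subgradients.
\<close>

lemma regret_bound:
  assumes run: "controller_run A B K0 \<kappa> \<gamma> T W L c w M" and L: "L \<ge> 0"
    and lip: "\<And>t. t \<in> {1..T} \<Longrightarrow> L-lipschitz_on X (c t)"
    and phys: "\<And>t. t \<in> {1..T} \<Longrightarrow> phys M t \<in> X"
    and lin: "\<And>t K. t \<in> {1..T} \<Longrightarrow> K \<in> policy_class A B \<kappa> \<gamma> \<Longrightarrow> lin K t \<in> X"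
    and int: "\<And>t N. W > 0 \<Longrightarrow> t \<in> {1..T} \<Longrightarrow> wnorm \<rho> H N \<le> R \<Longrightarrow> ref N t \<in> interior X"
  shows "regret A B (policy_class A B \<kappa> \<gamma>) T c w (phys M)
    \<le> 2 * \<kappa>\<^sup>2 * \<Delta> * \<psi>\<^sub>0 * L * W * (1 / \<gamma>) * sqrt (real T)" (is "_ \<le> ?bound")
proof -
  have \<psi>: "\<psi>\<^sub>0 > 0"
    using C0_ge_1 Psi0_ge_C0 by linarith
  have "(\<Sum>t = 1..T. c t (phys M t)) - ?bound \<le> (\<Sum>t = 1..T. c t (lin K t))"
    if K: "K \<in> policy_class A B \<kappa> \<gamma>" for K
  \<comment> \<open>In this case the step size is arbitrary. Either W = 0 and all trajectories
    vanish, or L = 0 and the costs are constant on X; no round has positive regret.\<close>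
  proof (cases "L * W = 0")
    case True
    have "c t (phys M t) - c t (lin K t) \<le> 0" if t: "t \<in> {1..T}" for t
    proof -
      have "L * norm (phys M t - lin K t) = 0"
      proof (cases "W = 0")
        case True
        then show ?thesis
          using phys_le[OF t, of M] iterate_in_ball[OF run] lin_le[OF K t] by simp
      next
        case False
        then show ?thesis
          using \<open>L * W = 0\<close> by simp
      qed
      then show ?thesis
        using lipschitz_on_diff_le[OF lip[OF t] phys[OF t] lin[OF t K]] by linarith
    qed
    then have "(\<Sum>t = 1..T. c t (phys M t) - c t (lin K t)) \<le> 0"
      by (rule sum_nonpos)
    moreover have "?bound = 0"
      using True by auto
    ultimately show ?thesis
      unfolding sum_subtractf by linarith
  next
    case False
    then have LW: "L > 0" "W > 0"
      using L W by auto
    let ?Q = "policy_blocks K"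
    have "(\<Sum>t = 1..T. c t (phys M t) - c t (ref ?Q t)) \<le> (S * R) * (L * W * \<psi>\<^sub>0 * sqrt (real T))"
      using descent_and_tracking_le[OF run LW lip phys int policy_blocks_in_ball[OF K]] LW
      by (simp add: mult_ac)
    also have "\<dots> \<le> (\<kappa>\<^sup>2 * \<Delta> / \<gamma>) * (L * W * \<psi>\<^sub>0 * sqrt (real T))"
      using LW \<psi> by (intro mult_right_mono S_R_le) auto
    finally have descent: "(\<Sum>t = 1..T. c t (phys M t) - c t (ref ?Q t)) \<le> ?bound / 2"
      by (simp add: mult_ac)
    have trunc: "c t (ref ?Q t) - c t (lin K t) \<le> L * W * \<kappa>\<^sup>2 * \<Delta> * \<psi>\<^sub>0 / (\<gamma> * sqrt (real T))"
      if t: "t \<in> {1..T}" for t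
    proof -
      have "ref ?Q t \<in> X"
        using int[OF LW(2) t policy_blocks_in_ball[OF K]] interior_subset by blast
      then have "c t (ref ?Q t) - c t (lin K t) \<le> L * norm (ref ?Q t - lin K t)"
        by (intro lipschitz_on_diff_le[OF lip[OF t]] lin t K)
      also have "\<dots> \<le> L * (c\<^sub>0 * (\<Delta> * \<kappa>\<^sup>2 * W * ((1 - \<gamma>) ^ H / \<gamma>)))"
        by (intro mult_left_mono ref_policy_blocks_dist_le K t L)
      also have "\<dots> \<le> L * (c\<^sub>0 * (\<Delta> * \<kappa>\<^sup>2 * W * ((\<psi>\<^sub>0 / (c\<^sub>0 * sqrt (real T))) / \<gamma>)))"
        using L C0_ge_1 \<Delta>_nonneg W \<gamma>
        by (intro mult_left_mono divide_right_mono truncation_factor_le) auto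
      also have "\<dots> = L * W * \<kappa>\<^sup>2 * \<Delta> * \<psi>\<^sub>0 / (\<gamma> * sqrt (real T))"
        using C0_ge_1 by (simp add: mult_ac)
      finally show ?thesis .
    qed
    \<comment> \<open>Truncation loses order 1 / sqrt T per round, hence order sqrt T in total, with
      the same constant as the descent part; this is the factor 2 in the bound.\<close>
    have "(\<Sum>t = 1..T. c t (ref ?Q t) - c t (lin K t))
        \<le> real T * (L * W * \<kappa>\<^sup>2 * \<Delta> * \<psi>\<^sub>0 / (\<gamma> * sqrt (real T)))"
      using sum_bounded_above[of "{1..T}", OF trunc] by simp
    also have "\<dots> = (L * W * \<kappa>\<^sup>2 * \<Delta> * \<psi>\<^sub>0 / \<gamma>) * (real T / sqrt (real T))"
      by simp
    also have "\<dots> = ?bound / 2"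
      by (simp add: real_div_sqrt mult_ac)
    finally show ?thesis
      using descent by (simp add: sum_subtractf)
  qed
  then have "(\<Sum>t = 1..T. c t (phys M t)) - ?bound
      \<le> (INF K \<in> policy_class A B \<kappa> \<gamma>. \<Sum>t = 1..T. c t (lin K t))"
    by (intro cINF_greatest nonempty)
  then show ?thesis
    by (simp add: regret_def)
qed

end

lemma regular_cost_lipschitz:
  fixes f :: "'a::euclidean_space \<Rightarrow> real"
  assumes "regular_cost G D f" "0 \<le> G * D"
  shows "(G * D)-lipschitz_on (cball 0 D) f"
proof -
  obtain f' where f': "\<And>y. GDERIV f y :> f' y" "\<And>y. y \<in> cball 0 D \<Longrightarrow> norm (f' y) \<le> G * D"
    using assms unfolding regular_cost_def by blast
  show ?thesis
  proof (rule bounded_derivative_imp_lipschitz)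
    show "(f has_derivative (\<lambda>h. inner h (f' y))) (at y within cball 0 D)" for y
      using f'(1) unfolding gderiv_def by (rule has_derivative_at_withinI)
    show "onorm (\<lambda>h. inner h (f' y)) \<le> G * D" if "y \<in> cball 0 D" for y
    proof (rule onorm_le)
      fix h
      have "norm (inner h (f' y)) \<le> norm h * norm (f' y)"
        by (simp add: Cauchy_Schwarz_ineq2)
      also have "\<dots> \<le> norm h * (G * D)"
        by (intro mult_left_mono f' that norm_ge_zero)
      finally show "norm (inner h (f' y)) \<le> G * D * norm h"
        by (simp add: mult.commute)
    qed
  qed (use assms in auto)
qed


subsection \<open>System constants\<close>

text \<open>
  The argument \<open>c\<close> stands for \<^term>\<open>frakC A B\<close> and \<open>d\<close> for the state dimension. The first three
  constants bound \<open>C\<^sub>0\<close>, \<open>\<Psi>\<^sub>0\<close> and \<open>sup \<parallel>K - K\<^sub>0\<parallel>\<close>.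
\<close>

definition sys_C0 :: "real \<Rightarrow> real" where
  "sys_C0 c = 2 * c + (1 + 2 * c * (2 * c))"

definition sys_Psi :: "real \<Rightarrow> real" where
  "sys_Psi c = sqrt ((sys_C0 c)\<^sup>2 + 2 * (2 * c) * (2 * c) * sys_C0 c)"

definition sys_Delta :: "nat \<Rightarrow> real \<Rightarrow> real \<Rightarrow> real" where
  "sys_Delta d \<kappa> c = sqrt (real d) * (\<kappa> + 2 * c)"

text \<open>With W/\<gamma> factored out, the summands bound the response to the disturbances under
  K0, the response to parameters in the ball, and the comparator trajectories.\<close>

definition sys_radius :: "nat \<Rightarrow> real \<Rightarrow> real \<Rightarrow> real" where
  "sys_radius d \<kappa> c = 2 * c + sys_C0 c * (\<kappa>\<^sup>2 * sys_Delta d \<kappa> c) + (1 + \<kappa>) * \<kappa>\<^sup>2"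

definition sys_regret :: "nat \<Rightarrow> real \<Rightarrow> real \<Rightarrow> real" where
  "sys_regret d \<kappa> c = 2 * \<kappa>\<^sup>2 * sys_Delta d \<kappa> c * sys_Psi c"

lemma sys_C0_nonneg: "c \<ge> 0 \<Longrightarrow> sys_C0 c \<ge> 0"
  by (simp add: sys_C0_def)

lemma sys_Psi_nonneg: "c \<ge> 0 \<Longrightarrow> sys_Psi c \<ge> 0"
  by (simp add: sys_Psi_def sys_C0_nonneg)

lemma sys_Delta_nonneg: "\<kappa> \<ge> 1 \<Longrightarrow> c \<ge> 0 \<Longrightarrow> sys_Delta d \<kappa> c \<ge> 0"
  by (simp add: sys_Delta_def)

lemma sys_radius_pos: "\<kappa> \<ge> 1 \<Longrightarrow> c \<ge> 0 \<Longrightarrow> sys_radius d \<kappa> c > 0"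
  unfolding sys_radius_def by (intro add_nonneg_pos) (auto simp: sys_C0_nonneg sys_Delta_nonneg)

lemma sys_regret_nonneg: "\<kappa> \<ge> 1 \<Longrightarrow> c \<ge> 0 \<Longrightarrow> sys_regret d \<kappa> c \<ge> 0"
  by (simp add: sys_regret_def sys_Psi_nonneg sys_Delta_nonneg)

locale bounded_response = weighted_response A B K0 \<kappa> \<gamma> W T w
  for A :: "real ^ 'x ^ 'x" and B :: "real ^ 'u ^ 'x" and K0 :: "real ^ 'x ^ 'u"
    and \<kappa> \<gamma> W :: real and T :: nat and w :: "nat \<Rightarrow> real ^ 'x" +
  fixes c :: real
  assumes Lam_le: "Lam A B K0 \<le> 2 * c" and LamB_le: "LamB A B K0 \<le> 2 * c"
begin

lemma c_nonneg: "c \<ge> 0"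
  using Lam_nonneg Lam_le by linarith

lemma K0_le: "opnorm K0 \<le> 2 * c"
  using opnorm_K0_le_Lam Lam_le by linarith

lemma C0_le: "c\<^sub>0 \<le> sys_C0 c"
proof -
  have "c\<^sub>0 \<le> \<Lambda>\<^sub>B + (1 + opnorm K0 * \<Lambda>\<^sub>B)"
    unfolding C0_def using LamB_nonneg by (intro sqrt_sum_squares_le_sum) auto
  also have "\<dots> \<le> sys_C0 c"
    unfolding sys_C0_def using LamB_le K0_le LamB_nonneg c_nonneg
    by (intro add_mono mult_mono) auto
  finally show ?thesis .
qed

lemma Psi0_le: "\<psi>\<^sub>0 \<le> sys_Psi c"
  unfolding Psi0_def sys_Psi_def
  using C0_le C0_ge_1 Lam_le LamB_le LamB_nonneg Lam_nonneg c_nonneg sys_C0_nonneg[of c]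
  by (intro real_sqrt_le_mono add_mono power_mono mult_mono) auto

lemma Delta_le: "\<Delta> \<le> sys_Delta CARD('x) \<kappa> c"
  using \<Delta>_le unfolding sys_Delta_def
  by (rule order_trans) (intro mult_left_mono add_left_mono K0_le, simp)

lemma regret_factor_le: "2 * \<kappa>\<^sup>2 * \<Delta> * \<psi>\<^sub>0 \<le> sys_regret CARD('x) \<kappa> c"
  unfolding sys_regret_def
  using Delta_le Psi0_le \<Delta>_nonneg c_nonneg \<kappa> C0_ge_1 Psi0_ge_C0
  by (intro mult_mono) (auto simp: sys_Delta_nonneg)

lemma response_radius_le: "\<Lambda> * W + c\<^sub>0 * (W * (S * R)) \<le> sys_radius CARD('x) \<kappa> c * W / \<gamma>"
proof -
  have "\<Lambda> * W \<le> (2 * c) * (W / \<gamma>)"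
    using Lam_le Lam_nonneg W \<gamma> c_nonneg
    by (intro mult_mono) (auto simp: pos_le_divide_eq mult_left_le)
  moreover have "c\<^sub>0 * (W * (S * R)) \<le> sys_C0 c * (W * (\<kappa>\<^sup>2 * sys_Delta CARD('x) \<kappa> c / \<gamma>))"
  proof (intro mult_mono C0_le)
    have "S * R \<le> \<kappa>\<^sup>2 * \<Delta> / \<gamma>"
      by (rule S_R_le)
    also have "\<dots> \<le> \<kappa>\<^sup>2 * sys_Delta CARD('x) \<kappa> c / \<gamma>"
      using \<gamma> Delta_le by (intro divide_right_mono mult_left_mono) auto
    finally show "S * R \<le> \<kappa>\<^sup>2 * sys_Delta CARD('x) \<kappa> c / \<gamma>" .
  qed (use W R_nonneg C0_ge_1 sys_C0_nonneg[OF c_nonneg] in auto)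
  moreover have "0 \<le> (1 + \<kappa>) * \<kappa>\<^sup>2 * W / \<gamma>"
    using \<kappa> \<gamma> W by simp
  ultimately show ?thesis
    by (simp add: sys_radius_def algebra_simps add_divide_distrib)
qed

lemma lin_radius_le: "(1 + \<kappa>) * \<kappa>\<^sup>2 * W / \<gamma> \<le> sys_radius CARD('x) \<kappa> c * W / \<gamma>"
  unfolding sys_radius_def using W \<gamma> \<kappa> c_nonneg sys_C0_nonneg[OF c_nonneg]
  by (intro divide_right_mono mult_right_mono) (auto simp: sys_Delta_nonneg)

lemma lin_norm_le:
  "K \<in> policy_class A B \<kappa> \<gamma> \<Longrightarrow> t \<in> {1..T} \<Longrightarrow> norm (lin K t) \<le> sys_radius CARD('x) \<kappa> c * W / \<gamma>"
  using lin_le lin_radius_le order_trans by blast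

lemma ref_norm_le:
  "t \<in> {1..T} \<Longrightarrow> wnorm \<rho> H M \<le> R \<Longrightarrow> norm (ref M t) \<le> sys_radius CARD('x) \<kappa> c * W / \<gamma>"
  using ref_le response_radius_le order_trans by blast

lemma phys_norm_le:
  "controller_run A B K0 \<kappa> \<gamma> T W L f w M \<Longrightarrow> t \<in> {1..T} \<Longrightarrow>
    norm (phys M t) \<le> sys_radius CARD('x) \<kappa> c * W / \<gamma>"
  using phys_le[of t M] iterate_in_ball[of L f M] response_radius_le by fastforce

lemma radius_nonneg: "0 \<le> sys_radius CARD('x) \<kappa> c * W / \<gamma>"
  using sys_radius_pos[OF \<kappa> c_nonneg, of "CARD('x)"] W \<gamma> by simp

lemma radius_pos: "W > 0 \<Longrightarrow> 0 < sys_radius CARD('x) \<kappa> c * W / \<gamma>"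
  using sys_radius_pos[OF \<kappa> c_nonneg, of "CARD('x)"] \<gamma> by simp

lemma regret_le:
  assumes "regret A B (policy_class A B \<kappa> \<gamma>) T f w (phys M)
      \<le> 2 * \<kappa>\<^sup>2 * \<Delta> * \<psi>\<^sub>0 * L * W * (1 / \<gamma>) * sqrt (real T)" and "0 \<le> L"
  shows "regret A B (policy_class A B \<kappa> \<gamma>) T f w (phys M)
      \<le> sys_regret CARD('x) \<kappa> c * L * W * (1 / \<gamma>) * sqrt (real T)"
  using assms(2) W \<gamma> by (intro order_trans[OF assms(1)] mult_right_mono regret_factor_le) auto

lemma lipschitz_regret_le:
  assumes run: "controller_run A B K0 \<kappa> \<gamma> T W L f w M"
    and lip: "\<And>t. t \<in> {1..T} \<Longrightarrow> L-lipschitz_on UNIV (f t)"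
  shows "regret A B (policy_class A B \<kappa> \<gamma>) T f w (phys M)
      \<le> sys_regret CARD('x) \<kappa> c * L * W * (1 / \<gamma>) * sqrt (real T)"
proof -
  have L: "0 \<le> L"
    using lip[of 1] T by (auto intro: lipschitz_on_nonneg)
  show ?thesis
    by (rule regret_le[OF regret_bound[OF run L lip] L]) auto
qed

text \<open>D is twice the radius of the trajectories, so that for W > 0 the reference points lie in
  the interior of the ball, as the subgradient bound requires.\<close>

lemma regular_regret_le:
  assumes G: "G \<ge> 0" and D: "D = 2 * (sys_radius CARD('x) \<kappa> c * W / \<gamma>)"
    and run: "controller_run A B K0 \<kappa> \<gamma> T W (G * D) f w M"
    and reg: "\<And>t. t \<in> {1..T} \<Longrightarrow> regular_cost G D (f t)"
  shows "regret A B (policy_class A B \<kappa> \<gamma>) T f w (phys M)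
      \<le> sys_regret CARD('x) \<kappa> c * (G * D) * W * (1 / \<gamma>) * sqrt (real T)"
proof -
  have L: "0 \<le> G * D"
    using G radius_nonneg D by (intro mult_nonneg_nonneg) linarith+
  have rD: "sys_radius CARD('x) \<kappa> c * W / \<gamma> \<le> D"
    unfolding D mult_2 by (rule add_increasing[OF radius_nonneg order_refl])
  have int: "ref N t \<in> interior (cball 0 D)"
    if "W > 0" "t \<in> {1..T}" "wnorm \<rho> H N \<le> R" for t N
    unfolding D mult_2 interior_cball mem_ball_0
    by (rule add_strict_increasing[OF radius_pos[OF that(1)] ref_norm_le[OF that(2,3)]])
  show ?thesis
  proof (rule regret_le[OF regret_bound[OF run L regular_cost_lipschitz[OF reg L] _ _ int] L])
    show "phys M t \<in> cball 0 D" if "t \<in> {1..T}" for t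
      using phys_norm_le[OF run that] rD by simp
    show "lin K t \<in> cball 0 D" if "t \<in> {1..T}" "K \<in> policy_class A B \<kappa> \<gamma>" for K t
      using lin_norm_le[OF that(2,1)] rD by simp
  qed
qed

end

text \<open>The dimensions enter the constant through the types. An adaptive environment is covered
  because the bounds hold for all cost and disturbance sequences.\<close>

theorem theorem5p1:
  shows "\<exists>(Csys :: real \<Rightarrow> real \<Rightarrow> real) (CH :: real).
    \<forall>(A :: real ^ 'x ^ 'x) (B :: real ^ 'u ^ 'x) (K0 :: real ^ 'x ^ 'u) (\<kappa> :: real) (\<gamma> :: real)
      (T :: nat) (W :: real).
      \<kappa> \<ge> 1 \<and> 0 < \<gamma> \<and> \<gamma> < 1 \<and> T \<ge> 1 \<and> W \<ge> 0 \<and>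
      policy_class A B \<kappa> \<gamma> \<noteq> {} \<and>
      schur_stable (A - B ** K0) \<and> track_cost A B K0 \<le> 2 * frakC A B \<longrightarrow>
      (let C = Csys \<kappa> (frakC A B);
           H = trunc_len A B K0 \<gamma> T;
           \<K> = policy_class A B \<kappa> \<gamma>
       in
         real H \<le> CH * (1 / \<gamma>) * ln (2 + real T / \<gamma>) \<and>
         (\<forall>L c w M.
            (\<forall>t \<in> {1..T}. norm (w t) \<le> W) \<and>
            (\<forall>t \<in> {1..T}. convex_on UNIV (c t) \<and> L-lipschitz_on UNIV (c t)) \<and>
            controller_run A B K0 \<kappa> \<gamma> T W L c w M \<longrightarrow>
            regret A B \<K> T c w (phys_traj A B K0 H w M) \<le> C * L * W * (1 / \<gamma>) * sqrt (real T)) \<and>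
         (\<exists>D. D \<le> C * W / \<gamma> \<and>
            (\<forall>w. (\<forall>t \<in> {1..T}. norm (w t) \<le> W) \<longrightarrow>
               (\<forall>K \<in> \<K>. \<forall>t \<in> {1..T}. lin_traj A B K w t \<in> cball 0 D) \<and>
               (\<forall>L c M. L \<ge> 0 \<and> (\<forall>t \<in> {1..T}. convex_on UNIV (c t)) \<and>
                  controller_run A B K0 \<kappa> \<gamma> T W L c w M \<longrightarrow>
                  (\<forall>t \<in> {1..T}. phys_traj A B K0 H w M t \<in> cball 0 D \<and>
                                ref_traj A B K0 H w (M t) t \<in> cball 0 D))) \<and>
            (\<forall>G c w M.
               G \<ge> 0 \<and>
               (\<forall>t \<in> {1..T}. norm (w t) \<le> W) \<and>
               (\<forall>t \<in> {1..T}. regular_cost G D (c t)) \<and>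
               controller_run A B K0 \<kappa> \<gamma> T W (G * D) c w M \<longrightarrow>
               regret A B \<K> T c w (phys_traj A B K0 H w M)
                 \<le> C * G * W\<^sup>2 * (1 / \<gamma>\<^sup>2) * sqrt (real T))))"
proof -
  let ?d = "CARD('x)"
  let ?r = "\<lambda>\<kappa> c. 2 * sys_radius ?d \<kappa> c"
  \<comment> \<open>A sum of nonnegative constants that dominates each of the three needed: the
    Lipschitz regret, the radius, and their product for regular costs.\<close>
  let ?C = "\<lambda>\<kappa> c. sys_regret ?d \<kappa> c + ?r \<kappa> c + sys_regret ?d \<kappa> c * ?r \<kappa> c"
  show ?thesis
  proof (rule exI[of _ ?C], rule exI[of _ 3], intro allI impI, goal_cases)
    case asm: (1 A B K0 \<kappa> \<gamma> T W)
    define c where "c = frakC A B"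
    define D where "D = ?r \<kappa> c * W / \<gamma>"
    have setting: "bounded_response A B K0 \<kappa> \<gamma> W T w c"
      if "\<forall>t\<in>{1..T}. norm (w t) \<le> W" for w
      using asm that by unfold_locales (auto simp: track_cost_def c_def)
    \<comment> \<open>D has to be fixed before the disturbances, so the facts about the constants
      are taken from the instance with zero disturbance.\<close>
    have "bounded_response A B K0 \<kappa> \<gamma> W T (\<lambda>_. 0) c"
      using asm by (intro setting) auto
    then interpret z: bounded_response A B K0 \<kappa> \<gamma> W T "\<lambda>_. 0" c .
    have reg0: "0 \<le> sys_regret ?d \<kappa> c" and rad0: "0 < sys_radius ?d \<kappa> c"
      using sys_regret_nonneg sys_radius_pos z.\<kappa> z.c_nonneg by auto
    have le1: "sys_regret ?d \<kappa> c \<le> ?C \<kappa> c" and le2: "?r \<kappa> c \<le> ?C \<kappa> c"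
      and le3: "sys_regret ?d \<kappa> c * ?r \<kappa> c \<le> ?C \<kappa> c"
      using reg0 rad0 by (auto intro: add_increasing add_increasing2)
    have D: "D = 2 * (sys_radius CARD('x) \<kappa> c * W / \<gamma>)"
      by (simp add: D_def)
    have rD: "sys_radius CARD('x) \<kappa> c * W / \<gamma> \<le> D"
      unfolding D mult_2 by (rule add_increasing[OF z.radius_nonneg order_refl])
    show ?case
      unfolding Let_def c_def[symmetric]
    proof (intro conjI allI impI exI[of _ D])
      show "real z.H \<le> 3 * (1 / \<gamma>) * ln (2 + real T / \<gamma>)"
        by (rule z.trunc_len_le)
      show "D \<le> ?C \<kappa> c * W / \<gamma>"
        unfolding D_def using le2 z.W z.\<gamma> by (intro divide_right_mono mult_right_mono) auto
    next
      fix L f w M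
      assume *: "(\<forall>t\<in>{1..T}. norm (w t) \<le> W) \<and>
        (\<forall>t\<in>{1..T}. convex_on UNIV (f t) \<and> L-lipschitz_on UNIV (f t)) \<and>
        controller_run A B K0 \<kappa> \<gamma> T W L f w M"
      interpret bounded_response A B K0 \<kappa> \<gamma> W T w c
        using * by (intro setting) auto
      have L: "0 \<le> L"
        using * T by (auto intro: lipschitz_on_nonneg)
      have "regret A B (policy_class A B \<kappa> \<gamma>) T f w (phys M)
          \<le> sys_regret ?d \<kappa> c * L * W * (1 / \<gamma>) * sqrt (real T)"
        using * by (intro lipschitz_regret_le) auto
      also have "\<dots> \<le> ?C \<kappa> c * L * W * (1 / \<gamma>) * sqrt (real T)"
        using le1 L W \<gamma> by (intro mult_right_mono) auto
      finally show "regret A B (policy_class A B \<kappa> \<gamma>) T f w (phys M)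
          \<le> ?C \<kappa> c * L * W * (1 / \<gamma>) * sqrt (real T)" .
    next
      fix w :: "nat \<Rightarrow> real ^ 'x"
      assume *: "\<forall>t\<in>{1..T}. norm (w t) \<le> W"
      interpret bounded_response A B K0 \<kappa> \<gamma> W T w c
        by (rule setting[OF *])
      show "\<forall>K\<in>policy_class A B \<kappa> \<gamma>. \<forall>t\<in>{1..T}. lin K t \<in> cball 0 D"
        using lin_norm_le rD by fastforce
      fix L f M
      assume "L \<ge> 0 \<and> (\<forall>t\<in>{1..T}. convex_on UNIV (f t)) \<and> controller_run A B K0 \<kappa> \<gamma> T W L f w M"
      then have run: "controller_run A B K0 \<kappa> \<gamma> T W L f w M"
        by simp
      show "\<forall>t\<in>{1..T}. phys M t \<in> cball 0 D \<and> ref (M t) t \<in> cball 0 D"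
      proof (intro ballI conjI)
        fix t assume t: "t \<in> {1..T}"
        show "phys M t \<in> cball 0 D"
          using phys_norm_le[OF run t] rD by simp
        show "ref (M t) t \<in> cball 0 D"
          using ref_norm_le[OF t iterate_in_ball[OF run t]] rD by simp
      qed
    next
      fix G f w M
      assume *: "G \<ge> 0 \<and> (\<forall>t\<in>{1..T}. norm (w t) \<le> W) \<and>
        (\<forall>t\<in>{1..T}. regular_cost G D (f t)) \<and> controller_run A B K0 \<kappa> \<gamma> T W (G * D) f w M"
      interpret bounded_response A B K0 \<kappa> \<gamma> W T w c
        using * by (intro setting) auto
      have "regret A B (policy_class A B \<kappa> \<gamma>) T f w (phys M)
          \<le> sys_regret ?d \<kappa> c * (G * D) * W * (1 / \<gamma>) * sqrt (real T)"
        using * D by (intro regular_regret_le) auto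
      \<comment> \<open>The Lipschitz constant G D contributes the second factor W/\<gamma>.\<close>
      also have "\<dots> = (sys_regret ?d \<kappa> c * ?r \<kappa> c) * G * W\<^sup>2 * (1 / \<gamma>\<^sup>2) * sqrt (real T)"
        by (simp add: D_def power2_eq_square)
      also have "\<dots> \<le> ?C \<kappa> c * G * W\<^sup>2 * (1 / \<gamma>\<^sup>2) * sqrt (real T)"
        using le3 * by (intro mult_right_mono) auto
      finally show "regret A B (policy_class A B \<kappa> \<gamma>) T f w (phys M)
          \<le> ?C \<kappa> c * G * W\<^sup>2 * (1 / \<gamma>\<^sup>2) * sqrt (real T)" .
    qed
  qed
qed

end
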